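(* Let $k\ge 2$ and let $T$ be a $k$-uniform hypertree of order $n$, where $T\not\cong P_{n,k}$ and $\frac{n-1}{k-1}\ge 4$. Then $\rho(T)\le\rho(F_{n,k})$, with equality if and only if $T\cong F_{n,k}$.
   Context: All hypergraphs are finite. A hypergraph $G$ consists of a nonempty vertex set $V(G)$ and an edge set $E(G)$ whose elements are nonempty subsets of $V(G)$. It is $k$-uniform ($k\ge 2$) if every edge has exactly $k$ vertices. The degree of a vertex is the number of edges containing it. A walk of length $p$ from $u$ to $v$ is a sequence $(v_0,e_1,v_1,\dots,v_{p-1},e_p,v_p)$ with $v_0=u$, $v_p=v$, each $e_i$ an edge containing $v_{i-1}$ and $v_i$, and $v_{i-1}\ne v_i$. A path is a walk with all $v_i$ distinct and all $e_i$ distinct; a single vertex is a path of length $0$. A cycle is a walk with at least two edges in which all $e_i$ are distinct and all $v_i$ are distinct except that the first and last vertices coincide. $G$ is connected if there is a path between any two vertices. A hypertree is a connected hypergraph with no cycles; a $k$-uniform hypertree with $m$ edges has order $n=1+(k-1)m$. For connected $G$, the distance $d_G(u,v)$ is the length of a shortest path from $u$ to $v$ (with $d_G(u,u)=0$), the distance matrix is $D(G)=(d_G(u,v))_{u,v\in V(G)}$, and the distance spectral radius $\rho(G)$ is the largest eigenvalue of $D(G)$. The $k$-uniform loose path $P_{n,k}$ of order $n=1+(k-1)m$ has vertices $v_1,\dots,v_n$ and edges $e_1,\dots,e_m$ with $e_i=\{v_{(i-1)(k-1)+1},\dots,v_{(i-1)(k-1)+k}\}$ for $i=1,\dots,m$.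 Attaching a pendant edge at a vertex $w$ means adding $k-1$ new vertices and one new edge consisting of $w$ and these new vertices. For $k\ge 3$ and $\frac{n-1}{k-1}\ge 3$, $F_{n,k}$ is the $k$-uniform hypertree obtained from the loose path $P_{n-k+1,k}$, with edges $e_1,e_2,\dots,e_{\frac{n-k}{k-1}}$ in order along the path, by attaching a pendant edge at a vertex of degree one in $e_2$. For $k=2$, $F_{n,2}=B^3_{n,2}$ is the tree of order $n$ obtained by identifying the center of a star with two edges (three vertices) with an end vertex of the path on $n-2$ vertices. *)

theory Defs
  imports Complex_Main "Jordan_Normal_Form.Char_Poly"
begin

section \<open>Hypergraphs\<close>

record 'a hypergraph =
  verts :: "'a set"
  edges :: "'a set set"

definition wf_hypergraph :: "'a hypergraph \<Rightarrow> bool" where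
  "wf_hypergraph G \<longleftrightarrow>
     finite (verts G) \<and> verts G \<noteq> {} \<and> (\<forall>e\<in>edges G. e \<noteq> {} \<and> e \<subseteq> verts G)"

definition uniform :: "nat \<Rightarrow> 'a hypergraph \<Rightarrow> bool" where
  "uniform k G \<longleftrightarrow> (\<forall>e\<in>edges G. card e = k)"

definition hdegree :: "'a hypergraph \<Rightarrow> 'a \<Rightarrow> nat" where
  "hdegree G v = card {e \<in> edges G. v \<in> e}"

definition hypergraph_iso :: "'a hypergraph \<Rightarrow> 'b hypergraph \<Rightarrow> bool" where
  "hypergraph_iso G H \<longleftrightarrow>
     (\<exists>f. bij_betw f (verts G) (verts H) \<and> (\<lambda>e. f ` e) ` edges G = edges H)"

text \<open>A walk \<open>(v\<^sub>0, e\<^sub>1, v\<^sub>1, \<dots>, e\<^sub>p, v\<^sub>p)\<close> is kept as its list of vertices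
  \<open>[v\<^sub>0, \<dots>, v\<^sub>p]\<close> together with its list of edges \<open>[e\<^sub>1, \<dots>, e\<^sub>p]\<close>, so that the edge
  at position \<open>i\<close> (counting from 0) joins the vertices at positions \<open>i\<close> and \<open>Suc i\<close>.
  Its length is the length of the edge list.\<close>

definition walk :: "'a hypergraph \<Rightarrow> 'a list \<Rightarrow> 'a set list \<Rightarrow> bool" where
  "walk G vs es \<longleftrightarrow>
     length vs = Suc (length es) \<and> set vs \<subseteq> verts G \<and> set es \<subseteq> edges G \<and>
     (\<forall>i < length es. vs ! i \<in> es ! i \<and> vs ! Suc i \<in> es ! i \<and> vs ! i \<noteq> vs ! Suc i)"

definition is_path :: "'a hypergraph \<Rightarrow> 'a list \<Rightarrow> 'a set list \<Rightarrow> bool" where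
  "is_path G vs es \<longleftrightarrow> walk G vs es \<and> distinct vs \<and> distinct es"

definition path_between :: "'a hypergraph \<Rightarrow> 'a \<Rightarrow> 'a \<Rightarrow> 'a list \<Rightarrow> 'a set list \<Rightarrow> bool" where
  "path_between G u v vs es \<longleftrightarrow> is_path G vs es \<and> hd vs = u \<and> last vs = v"

definition is_cycle :: "'a hypergraph \<Rightarrow> 'a list \<Rightarrow> 'a set list \<Rightarrow> bool" where
  "is_cycle G vs es \<longleftrightarrow>
     walk G vs es \<and> 2 \<le> length es \<and> distinct es \<and> distinct (butlast vs) \<and> hd vs = last vs"

definition connected_hypergraph :: "'a hypergraph \<Rightarrow> bool" where
  "connected_hypergraph G \<longleftrightarrow>
     (\<forall>u\<in>verts G. \<forall>v\<in>verts G. \<exists>vs es. path_between G u v vs es)"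

definition hypertree :: "'a hypergraph \<Rightarrow> bool" where
  "hypertree G \<longleftrightarrow>
     wf_hypergraph G \<and> connected_hypergraph G \<and> \<not> (\<exists>vs es. is_cycle G vs es)"

section \<open>Distance matrix and distance spectral radius\<close>

definition hdist :: "'a hypergraph \<Rightarrow> 'a \<Rightarrow> 'a \<Rightarrow> nat" where
  "hdist G u v = (LEAST p. \<exists>vs es. path_between G u v vs es \<and> length es = p)"

text \<open>The library matrices are indexed by initial segments of the naturals, so the vertices
  are listed in some order; by \<open>eigenvalue_distance_matrix_iff\<close> below the eigenvalues do
  not depend on it.\<close>

definition vertex_list :: "'a hypergraph \<Rightarrow> 'a list" where
  "vertex_list G = (SOME vs. distinct vs \<and> set vs = verts G)"

definition distance_matrix :: "'a hypergraph \<Rightarrow> real mat" where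
  "distance_matrix G =
     mat (card (verts G)) (card (verts G))
       (\<lambda>(i, j). real (hdist G (vertex_list G ! i) (vertex_list G ! j)))"

text \<open>For connected \<open>G\<close> the matrix is real symmetric of positive size, so all its
  eigenvalues are real and the set below is finite and nonempty.\<close>

definition distance_spectral_radius :: "'a hypergraph \<Rightarrow> real" where
  "distance_spectral_radius G = Max {x. eigenvalue (distance_matrix G) x}"

lemma vertex_list:
  assumes "finite (verts G)"
  shows "distinct (vertex_list G)" "set (vertex_list G) = verts G"
    "length (vertex_list G) = card (verts G)"
proof -
  obtain vs where "distinct vs \<and> set vs = verts G"
    using finite_distinct_list[OF assms] by blast
  then have "distinct (vertex_list G) \<and> set (vertex_list G) = verts G"
    unfolding vertex_list_def by (rule someI)
  then show "distinct (vertex_list G)" "set (vertex_list G) = verts G"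
    "length (vertex_list G) = card (verts G)"
    using distinct_card by fastforce+
qed

lemma eigenvalue_distance_matrix_iff:
  assumes fin: "finite (verts G)"
  shows "eigenvalue (distance_matrix G) c \<longleftrightarrow>
    (\<exists>x :: 'a \<Rightarrow> real. (\<exists>v\<in>verts G. x v \<noteq> 0) \<and>
       (\<forall>u\<in>verts G. (\<Sum>v\<in>verts G. real (hdist G u v) * x v) = c * x u))"
    (is "?L \<longleftrightarrow> ?R")
proof -
  define vs where "vs = vertex_list G"
  define n where "n = card (verts G)"
  have d: "distinct vs" and s: "set vs = verts G" and l: "length vs = n"
    using vertex_list[OF fin] by (simp_all add: vs_def n_def)
  have bij: "bij_betw ((!) vs) {0..<n} (verts G)"
    using bij_betw_nth[OF d, of "{0..<n}" "verts G"] s l by (auto simp: atLeast0LessThan)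
  have D: "distance_matrix G = mat n n (\<lambda>(i, j). real (hdist G (vs ! i) (vs ! j)))"
    by (simp add: distance_matrix_def vs_def n_def)
  have key: "eigenvector (distance_matrix G) (vec n (\<lambda>i. x (vs ! i))) c \<longleftrightarrow>
      (\<exists>v\<in>verts G. x v \<noteq> 0) \<and>
      (\<forall>u\<in>verts G. (\<Sum>v\<in>verts G. real (hdist G u v) * x v) = c * x u)" for x
  proof -
    have img: "verts G = (\<lambda>i. vs ! i) ` {0..<n}" using bij by (simp add: bij_betw_def)
    have sum: "(\<Sum>v\<in>verts G. real (hdist G u v) * x v) =
        (\<Sum>j = 0..<n. real (hdist G u (vs ! j)) * x (vs ! j))" for u
      by (rule sum.reindex_bij_betw[OF bij, symmetric])
    have nz: "vec n (\<lambda>i. x (vs ! i)) \<noteq> 0\<^sub>v n \<longleftrightarrow> (\<exists>v\<in>verts G. x v \<noteq> 0)"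
      unfolding img by (auto simp: vec_eq_iff)
    have eq: "distance_matrix G *\<^sub>v vec n (\<lambda>i. x (vs ! i)) = c \<cdot>\<^sub>v vec n (\<lambda>i. x (vs ! i)) \<longleftrightarrow>
        (\<forall>u\<in>verts G. (\<Sum>v\<in>verts G. real (hdist G u v) * x v) = c * x u)"
      unfolding sum unfolding img D by (auto simp: vec_eq_iff scalar_prod_def)
    show ?thesis unfolding eigenvector_def nz[symmetric] eq by (simp add: D)
  qed
  show ?thesis
  proof
    assume ?L
    then obtain y where y: "eigenvector (distance_matrix G) y c"
      by (auto simp: eigenvalue_def)
    then have dim: "dim_vec y = n" by (simp add: eigenvector_def D carrier_vecD)
    define x where "x v = y $ (inv_into {0..<n} ((!) vs) v)" for v
    have "y = vec n (\<lambda>i. x (vs ! i))"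
      using bij dim by (auto simp: x_def vec_eq_iff bij_betw_def)
    then show ?R using y key by metis
  next
    assume ?R
    then show ?L using key unfolding eigenvalue_def by blast
  qed
qed

section \<open>The loose path and the extremal hypertree\<close>

definition loose_edge :: "nat \<Rightarrow> nat \<Rightarrow> nat set" where
  "loose_edge k i = {(i - 1) * (k - 1) + 1 .. (i - 1) * (k - 1) + k}"

text \<open>Only meaningful for \<open>k \<ge> 2\<close> and \<open>n = 1 + (k - 1) * m\<close>, when the quotient
  below is the number \<open>m\<close> of edges.\<close>

definition loose_path :: "nat \<Rightarrow> nat \<Rightarrow> nat hypergraph" where
  "loose_path n k =
     \<lparr>verts = {1..n}, edges = loose_edge k ` {1..(n - 1) div (k - 1)}\<rparr>"

text \<open>\<open>A\<close> is the set of the new vertices.\<close>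

definition attach_pendant :: "'a hypergraph \<Rightarrow> 'a \<Rightarrow> 'a set \<Rightarrow> 'a hypergraph" where
  "attach_pendant G w A =
     \<lparr>verts = verts G \<union> A, edges = insert (insert w A) (edges G)\<rparr>"

definition star :: "'a \<Rightarrow> 'a set \<Rightarrow> 'a hypergraph" where
  "star c A = \<lparr>verts = insert c A, edges = (\<lambda>a. {c, a}) ` A\<rparr>"

text \<open>The union of two hypergraphs having a single common vertex is the result of
  identifying that vertex of the one with that vertex of the other.\<close>

definition hunion :: "'a hypergraph \<Rightarrow> 'a hypergraph \<Rightarrow> 'a hypergraph" where
  "hunion G H = \<lparr>verts = verts G \<union> verts H, edges = edges G \<union> edges H\<rparr>"

text \<open>For \<open>k = 2\<close> the center of the star is the end vertex \<open>n - 2\<close> of the path.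
  For \<open>k \<ge> 3\<close> all admissible choices of the vertex \<open>w\<close> give isomorphic hypertrees.\<close>

definition F_hypertree :: "nat \<Rightarrow> nat \<Rightarrow> nat hypergraph" where
  "F_hypertree n k =
     (if k = 2 then hunion (loose_path (n - 2) 2) (star (n - 2) {n - 1, n})
      else attach_pendant (loose_path (n - k + 1) k)
             (SOME w. w \<in> loose_edge k 2 \<and> hdegree (loose_path (n - k + 1) k) w = 1)
             {n - k + 2..n})"

lemma F_hypertree_attachment_vertex_exists:
  assumes k: "3 \<le> k" and n: "n = 1 + (k - 1) * m" and m: "3 \<le> m"
  shows "\<exists>w. w \<in> loose_edge k 2 \<and> hdegree (loose_path (n - k + 1) k) w = 1"
proof (intro exI conjI)
  obtain q where q: "k = q + 3" using k by (metis add.commute le_Suc_ex)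
  obtain r where r: "m = r + 3" using m by (metis add.commute le_Suc_ex)
  have nk: "n - k + 1 = 1 + (k - 1) * (r + 2)"
  proof -
    have "n = k + (k - 1) * (r + 2)" by (simp add: n q r algebra_simps)
    then show ?thesis by simp
  qed
  have edges: "edges (loose_path (n - k + 1) k) = loose_edge k ` {1..r + 2}"
  proof -
    have "(1 + (k - 1) * (r + 2) - 1) div (k - 1) = r + 2"
      using k by (simp only: add_diff_cancel_left') (rule nonzero_mult_div_cancel_left, simp)
    then show ?thesis unfolding loose_path_def nk by (simp only: hypergraph.select_convs)
  qed
  show "k + 1 \<in> loose_edge k 2" using q by (simp add: loose_edge_def)
  have only: "i = 2" if "k + 1 \<in> loose_edge k i" for i
  proof -
    have lo: "(i - 1) * (q + 2) \<le> q + 3" and hi: "q + 4 \<le> (i - 1) * (q + 2) + q + 3"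
      using that by (auto simp: loose_edge_def q)
    have "i - 1 \<noteq> 0" using hi by auto
    moreover have "\<not> 2 \<le> i - 1"
    proof
      assume "2 \<le> i - 1"
      then have "2 * (q + 2) \<le> (i - 1) * (q + 2)" by (rule mult_le_mono1)
      then show False using lo by simp
    qed
    ultimately show ?thesis by linarith
  qed
  have "{e \<in> edges (loose_path (n - k + 1) k). k + 1 \<in> e} = {loose_edge k 2}"
  proof (intro equalityI subsetI)
    fix e assume "e \<in> {e \<in> edges (loose_path (n - k + 1) k). k + 1 \<in> e}"
    then show "e \<in> {loose_edge k 2}" using only unfolding edges by blast
  next
    fix e assume e: "e \<in> {loose_edge k 2}"
    have "2 \<in> {1..r + 2}" by simp
    then show "e \<in> {e \<in> edges (loose_path (n - k + 1) k). k + 1 \<in> e}"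
      using e \<open>k + 1 \<in> loose_edge k 2\<close> unfolding edges by blast
  qed
  then show "hdegree (loose_path (n - k + 1) k) (k + 1) = 1"
    by (simp add: hdegree_def)
qed

end

(*
  Say that a hypertree branches if some vertex lies in three edges or some edge has three vertices
  lying in further edges; the hypertrees that do not branch are the loose paths. Among the
  branching hypertrees on a fixed vertex set take one of largest radius rho, with Perron vector x
  and potential p u = sum_b d(u, b) * x b = rho * x u. Detach an edge f from its vertex v and
  reattach it at a vertex u on v's side of f, and let c be the weight of the vertices beyond v.
  The quadratic form of the new distance matrix exceeds the old one by
  2 * c * (p u - p v - c * d(u, v)) at x, and by
  2 * (c - s) * (p u - p v - (c - s) * d(u, v)), where s = x u - x v, at x with the values at u
  and v exchanged. As p u - p v = rho * s, one of the two is positive whenever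
  p u - p v > (c - s) * d(u, v) and rho > d(u, v), so that the result cannot branch.
  Differences of p along an edge are differences of the weights of the parts into which the edge
  splits the hypertree, and comparing the weights of the branches at a branching vertex or edge
  shows that moves of distance at most 2 are possible on everything but F.
*)
theory Submission
  imports Defs "HOL-Analysis.Function_Topology"
begin

section \<open>Quadratic forms with positive off-diagonal entries\<close>

text \<open>The radius of \<open>F\<close> is never computed: every maximiser in the finite class of
  branching hypertrees is shown to be isomorphic to \<open>F\<close>. This gives the bound, and
  applied to \<open>T\<close> itself when equality holds it gives uniqueness. Competitors have to
  branch because a move may end in the loose path. Two encodings keep moves manageable. Distances
  are certified locally by \<open>dist_from\<close>, so the distances after a move can be written
  down and checked edge by edge. Acyclicity is replaced by the count
  \<open>1 + (k - 1) * card E\<close>, which a move visibly preserves and which forces parent edges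
  to be unique. The exchanged trial vector lowers the threshold for a gain from
  \<open>c * d u v\<close> to \<open>(c - s) * d u v\<close>; the values \<open>x u\<close> and
  \<open>x v\<close> in \<open>s\<close> are then absorbed by the weights of the parts containing
  \<open>u\<close> and \<open>v\<close>, so that only branch weights remain to be compared. Four
  edges serve twice: they put the radius above 2, the longest distance of a move, and they exclude
  three edges at one vertex with nothing else, where the case of a branching vertex ends when
  \<open>k >= 3\<close>.\<close>

definition quad :: "'a set \<Rightarrow> ('a \<Rightarrow> 'a \<Rightarrow> real) \<Rightarrow> ('a \<Rightarrow> real) \<Rightarrow> real" where
  "quad V w x = (\<Sum>a\<in>V. \<Sum>b\<in>V. w a b * x a * x b)"

definition sqn :: "'a set \<Rightarrow> ('a \<Rightarrow> real) \<Rightarrow> real" where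
  "sqn V x = (\<Sum>a\<in>V. (x a)^2)"

lemma sqn_pos:
  assumes "finite V" "v \<in> V" "x v \<noteq> 0"
  shows "0 < sqn V x"
  unfolding sqn_def by (rule sum_pos2[OF assms(1,2)]) (use assms(3) in auto)

text \<open>The sphere is taken among functions with values in [-1, 1] that vanish off
  \<open>V\<close>. That set is compact by Tychonoff, and neither \<open>quad\<close> nor
  \<open>sqn\<close> sees values off \<open>V\<close>.\<close>

lemma quad_attains_max:
  fixes w :: "'a \<Rightarrow> 'a \<Rightarrow> real"
  assumes fin: "finite V" and ne: "V \<noteq> {}"
  obtains x where "sqn V x = 1" "\<And>y. sqn V y = 1 \<Longrightarrow> quad V w y \<le> quad V w x"
proof -
  define K where "K = PiE UNIV (\<lambda>i. if i \<in> V then {-1..1::real} else {0})"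
  define S where "S = K \<inter> {x. sqn V x = 1}"
  have "compactin (product_topology (\<lambda>i. euclidean) UNIV) K"
    unfolding K_def compactin_PiE by auto
  then have K: "compact K"
    by (simp add: euclidean_product_topology)
  have cs: "continuous_on UNIV (sqn V)"
    unfolding sqn_def by (intro continuous_intros) simp
  have cq: "continuous_on UNIV (quad V w)"
    unfolding quad_def by (intro continuous_intros) simp_all
  have "closed {x. sqn V x = 1}"
    by (rule closed_Collect_eq[OF cs]) simp
  then have S: "compact S"
    unfolding S_def using K by (rule compact_Int_closed[rotated])
  obtain v where v: "v \<in> V" using ne by blast
  have "sqn V (\<lambda>a. if a = v then 1 else 0) = 1"
    unfolding sqn_def using fin v by (simp add: if_distrib[of "\<lambda>t. t^2"] cong: if_cong)
  then have "(\<lambda>a. if a = v then 1 else 0) \<in> S"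
    using v by (auto simp: S_def K_def)
  then obtain x where x: "x \<in> S" "\<And>y. y \<in> S \<Longrightarrow> quad V w y \<le> quad V w x"
    using continuous_attains_sup[OF S, of "quad V w"] continuous_on_subset[OF cq] by blast
  show thesis
  proof (rule that)
    show "sqn V x = 1" using x(1) by (simp add: S_def)
    fix y assume y: "sqn V y = 1"
    define z where "z a = (if a \<in> V then y a else 0)" for a
    have e: "quad V w z = quad V w y" "sqn V z = sqn V y"
      by (auto simp: quad_def sqn_def z_def)
    have "\<bar>y a\<bar> \<le> 1" if "a \<in> V" for a
    proof -
      have "(y a)^2 \<le> sqn V y"
        unfolding sqn_def by (rule member_le_sum[OF that]) (use fin in auto)
      then show ?thesis using y by (simp add: abs_square_le_1)
    qed
    then have "z \<in> S" using y e(2) by (fastforce simp: S_def K_def z_def abs_le_iff)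
    then show "quad V w y \<le> quad V w x" using x(2) e(1) by metis
  qed
qed

lemma quad_scale: "quad V w (\<lambda>a. c * x a) = c^2 * quad V w x"
  by (simp add: quad_def sum_distrib_left power2_eq_square mult_ac)

lemma sqn_scale: "sqn V (\<lambda>a. c * x a) = c^2 * sqn V x"
  by (simp add: sqn_def sum_distrib_left power_mult_distrib)

lemma quad_le_max:
  assumes "finite V" and "\<And>y. sqn V y = 1 \<Longrightarrow> quad V w y \<le> m"
  shows "quad V w y \<le> m * sqn V y"
proof (cases "\<exists>v\<in>V. y v \<noteq> 0")
  case True
  then obtain v where v: "v \<in> V" "y v \<noteq> 0" by blast
  have p: "0 < sqn V y" using sqn_pos[of V v y] assms(1) v by blast
  define c where "c = 1 / sqrt (sqn V y)"
  have c2: "c^2 = 1 / sqn V y" using p by (simp add: c_def power_divide)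
  have "sqn V (\<lambda>a. c * y a) = 1" using p by (simp add: sqn_scale c2)
  then have "c^2 * quad V w y \<le> m" using assms(2) quad_scale by metis
  then show ?thesis using p by (simp add: c2 field_simps)
next
  case False
  then show ?thesis by (simp add: quad_def sqn_def)
qed

text \<open>First-order condition: \<open>m * sqn V y - quad V w y\<close> is never negative and
  vanishes at \<open>x\<close>, so its linear term vanishes when \<open>x\<close> is changed at the
  single point \<open>u\<close>.\<close>

lemma quad_maximiser_eigenvector:
  assumes fin: "finite V" and sym: "\<And>a b. a \<in> V \<Longrightarrow> b \<in> V \<Longrightarrow> w a b = w b a"
    and le: "\<And>y. quad V w y \<le> m * sqn V y"
    and eq: "quad V w x = m * sqn V x" and u: "u \<in> V"
  shows "(\<Sum>v\<in>V. w u v * x v) = m * x u"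
proof -
  define g where "g = (\<Sum>v\<in>V. w u v * x v) - m * x u"
  have Q: "quad V w (x(u := x u + t)) = quad V w x + 2 * t * (\<Sum>v\<in>V. w u v * x v) + t^2 * w u u" for t
  proof -
    define i where "i a = (if a = u then t else 0)" for a
    have x: "x(u := x u + t) = (\<lambda>a. x a + i a)" by (auto simp: i_def)
    have i1: "(\<Sum>a\<in>V. h a * i a) = h u * t" for h
      using fin u by (simp add: i_def if_distrib cong: if_cong)
    have "quad V w (x(u := x u + t)) =
      quad V w x + (\<Sum>a\<in>V. (\<Sum>b\<in>V. (w a b * x a) * i b)) + (\<Sum>a\<in>V. (\<Sum>b\<in>V. w a b * x b) * i a)
        + (\<Sum>a\<in>V. (\<Sum>b\<in>V. w a b * i b) * i a)"
      unfolding quad_def x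
      by (simp add: algebra_simps sum.distrib sum_distrib_left)
    also have "\<dots> = quad V w x + (\<Sum>a\<in>V. w a u * x a * t) + (\<Sum>b\<in>V. w u b * x b) * t + w u u * t * t"
      by (simp only: i1)
    also have "(\<Sum>a\<in>V. w a u * x a * t) = (\<Sum>a\<in>V. w u a * x a) * t"
      unfolding sum_distrib_right by (rule sum.cong) (use sym u in auto)
    finally show ?thesis by (simp add: fun_upd_def power2_eq_square algebra_simps)
  qed
  have N: "sqn V (x(u := x u + t)) = sqn V x + 2 * t * x u + t^2" for t
  proof -
    have "sqn V (x(u := x u + t)) = (x u + t)^2 + (\<Sum>a\<in>V - {u}. (x a)^2)"
      unfolding sqn_def using fin u by (subst sum.remove[of _ u]) auto
    moreover have "sqn V x = (x u)^2 + (\<Sum>a\<in>V - {u}. (x a)^2)"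
      unfolding sqn_def using fin u by (subst sum.remove[of _ u]) auto
    ultimately show ?thesis by (simp add: power2_eq_square algebra_simps)
  qed
  have main: "2 * t * g + t^2 * (w u u - m) \<le> 0" for t
    using le[of "x(u := x u + t)"] eq unfolding Q N g_def by (simp add: algebra_simps)
  have "g = 0"
  proof (rule ccontr)
    assume g: "g \<noteq> 0"
    \<comment> \<open>At \<open>t = g / D\<close> the linear term is \<open>2 * g^2 / D\<close>,
      while the quadratic one is at most \<open>g^2 / D\<close> in absolute value.\<close>
    define D where "D = \<bar>w u u - m\<bar> + 1"
    have D: "D > 0" "\<bar>w u u - m\<bar> < D" by (auto simp: D_def)
    have "(g/D)^2 * (w u u - m) \<ge> - ((g/D)^2 * D)"
      using D mult_left_mono[of "-D" "w u u - m" "(g/D)^2"] by (simp add: abs_if split: if_splits)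
    moreover have "2 * (g/D) * g = 2 * g^2 / D" "(g/D)^2 * D = g^2 / D"
      using D by (auto simp: power2_eq_square)
    moreover have "g^2/D > 0" using g D by simp
    ultimately show False using main[of "g/D"] by linarith
  qed
  then show ?thesis by (simp add: g_def)
qed

text \<open>Taking absolute values cannot decrease the form, so a nonnegative maximiser exists; it
  is an eigenvector, and a zero entry would contradict the positivity of its row sum.\<close>

lemma perron_vector:
  assumes fin: "finite V" and two: "2 \<le> card V"
    and sym: "\<And>a b. a \<in> V \<Longrightarrow> b \<in> V \<Longrightarrow> w a b = w b a"
    and nonneg: "\<And>a b. a \<in> V \<Longrightarrow> b \<in> V \<Longrightarrow> 0 \<le> w a b"
    and pos: "\<And>a b. a \<in> V \<Longrightarrow> b \<in> V \<Longrightarrow> a \<noteq> b \<Longrightarrow> 0 < w a b"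
  obtains m x where "\<And>v. v \<in> V \<Longrightarrow> 0 < x v"
    "\<And>u. u \<in> V \<Longrightarrow> (\<Sum>v\<in>V. w u v * x v) = m * x u"
    "\<And>y. quad V w y \<le> m * sqn V y"
proof -
  have ne: "V \<noteq> {}" using two by auto
  obtain x0 where x0: "sqn V x0 = 1" "\<And>y. sqn V y = 1 \<Longrightarrow> quad V w y \<le> quad V w x0"
    using quad_attains_max[OF fin ne] by metis
  define m where "m = quad V w x0"
  define x where "x a = \<bar>x0 a\<bar>" for a
  have le: "quad V w y \<le> m * sqn V y" for y
    using quad_le_max[OF fin x0(2)] by (simp add: m_def)
  have nx: "sqn V x = 1" using x0(1) by (simp add: sqn_def x_def)
  have "quad V w x0 \<le> quad V w x"
    unfolding quad_def
    by (intro sum_mono) (auto simp: x_def mult.assoc abs_mult[symmetric] intro!: mult_left_mono nonneg)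
  with le[of x] nx have eq: "quad V w x = m * sqn V x" by (simp add: m_def)
  have ev: "(\<Sum>v\<in>V. w u v * x v) = m * x u" if "u \<in> V" for u
    using quad_maximiser_eigenvector[OF fin sym le eq that] .
  have "\<exists>v\<in>V. x v \<noteq> 0" using nx by (auto simp: sqn_def intro: ccontr)
  then obtain v where v: "v \<in> V" "0 < x v" by (auto simp: x_def)
  have x_nn: "0 \<le> x a" for a by (simp add: x_def)
  have sp: "0 < (\<Sum>b\<in>V. w u b * x b)" if u: "u \<in> V" "u \<noteq> v" for u
    by (rule sum_pos2[OF fin v(1)]) (use u v pos nonneg x_nn in auto)
  have "V \<noteq> {v}" using two by auto
  then obtain u where u: "u \<in> V" "u \<noteq> v" using v(1) by blast
  have "0 < m * x u" using sp[OF u] ev[OF u(1)] by simp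
  then have m: "0 < m" using x_nn[of u] by (simp add: zero_less_mult_iff)
  have xp: "0 < x a" if a: "a \<in> V" for a
  proof (cases "a = v")
    case False
    then have "0 < m * x a" using sp[OF a] ev[OF a] by simp
    then show ?thesis using m by (simp add: zero_less_mult_iff)
  qed (use v in simp)
  show thesis using that xp ev le by blast
qed

text \<open>An eigenvector for \<open>c\<close> has form value \<open>c\<close> times its square
  norm, so no eigenvalue exceeds the maximum of the form. Finiteness of the spectrum, needed for
  \<open>Max\<close>, comes from the characteristic polynomial.\<close>

lemma distance_spectral_radius_perron:
  fixes G :: "'a hypergraph"
  assumes fin: "finite (verts G)" and two: "2 \<le> card (verts G)"
    and sym: "\<And>a b. a \<in> verts G \<Longrightarrow> b \<in> verts G \<Longrightarrow> hdist G a b = hdist G b a"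
    and pos: "\<And>a b. a \<in> verts G \<Longrightarrow> b \<in> verts G \<Longrightarrow> a \<noteq> b \<Longrightarrow> 0 < hdist G a b"
  obtains x where "\<And>v. v \<in> verts G \<Longrightarrow> 0 < x v"
    "\<And>u. u \<in> verts G \<Longrightarrow>
      (\<Sum>v\<in>verts G. real (hdist G u v) * x v) = distance_spectral_radius G * x u"
    "\<And>y. quad (verts G) (\<lambda>a b. real (hdist G a b)) y \<le>
      distance_spectral_radius G * sqn (verts G) y"
proof -
  let ?V = "verts G" and ?w = "\<lambda>a b. real (hdist G a b)"
  obtain m x where m: "\<And>v. v \<in> ?V \<Longrightarrow> 0 < x v"
    "\<And>u. u \<in> ?V \<Longrightarrow> (\<Sum>v\<in>?V. ?w u v * x v) = m * x u"
    "\<And>y. quad ?V ?w y \<le> m * sqn ?V y"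
    by (rule perron_vector[OF fin two, of ?w]) (use sym pos in auto)
  have "?V \<noteq> {}" using two by auto
  then obtain v where v: "v \<in> ?V" by blast
  have "\<exists>v\<in>?V. x v \<noteq> 0" using m(1)[OF v] v by (intro bexI[of _ v]) auto
  then have mem: "m \<in> {c. eigenvalue (distance_matrix G) c}"
    using m(2) by (auto simp: eigenvalue_distance_matrix_iff[OF fin] intro!: exI[of _ x])
  have up: "c \<le> m" if "c \<in> {c. eigenvalue (distance_matrix G) c}" for c
  proof -
    from that obtain y v where y: "v \<in> ?V" "y v \<noteq> 0"
      "\<And>u. u \<in> ?V \<Longrightarrow> (\<Sum>v\<in>?V. ?w u v * y v) = c * y u"
      by (auto simp: eigenvalue_distance_matrix_iff[OF fin])
    have "quad ?V ?w y = (\<Sum>a\<in>?V. y a * (\<Sum>b\<in>?V. ?w a b * y b))"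
      by (simp add: quad_def sum_distrib_left mult_ac)
    also have "\<dots> = (\<Sum>a\<in>?V. y a * (c * y a))"
      by (rule sum.cong) (simp_all only: y(3))
    also have "\<dots> = c * sqn ?V y"
      by (simp add: sqn_def sum_distrib_left power2_eq_square mult_ac)
    finally show ?thesis using m(3)[of y] sqn_pos[OF fin y(1), of y] y(2) by simp
  qed
  let ?n = "card ?V"
  have D: "distance_matrix G \<in> carrier_mat ?n ?n" by (simp add: distance_matrix_def)
  have "{c. eigenvalue (distance_matrix G) c} = {c. poly (char_poly (distance_matrix G)) c = 0}"
    using eigenvalue_root_char_poly[OF D] by auto
  moreover have "char_poly (distance_matrix G) \<noteq> 0"
    using degree_monic_char_poly[OF D] two by auto
  ultimately have "finite {c. eigenvalue (distance_matrix G) c}"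
    using poly_roots_finite by metis
  then have "distance_spectral_radius G = m"
    unfolding distance_spectral_radius_def using mem up by (intro Max_eqI) auto
  then show thesis using that m by metis
qed

section \<open>Distance functions and paths\<close>

text \<open>A local certificate that \<open>r\<close> is the distance from \<open>a\<close>: it can
  be checked edge by edge without looking at paths. \<open>W\<close> need not contain all vertices,
  so that the certificate also describes a component left after deleting an edge.\<close>

definition dist_from :: "'a set \<Rightarrow> 'a set set \<Rightarrow> 'a \<Rightarrow> ('a \<Rightarrow> nat) \<Rightarrow> bool" where
  "dist_from W E a r \<longleftrightarrow>
     (\<forall>b\<in>W. r b = 0 \<longleftrightarrow> b = a) \<and>
     (\<forall>e\<in>E. \<forall>w\<in>e \<inter> W. \<forall>w'\<in>e \<inter> W. r w' \<le> r w + 1) \<and>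
     (\<forall>b\<in>W. b \<noteq> a \<longrightarrow> (\<exists>e\<in>E. b \<in> e \<and> (\<exists>w\<in>e \<inter> W. r b = r w + 1)))"

text \<open>Along a walk built from descents \<open>r\<close> equals the position, so vertices do
  not repeat. A repeated edge would contain two vertices whose values of \<open>r\<close> differ by
  at least 2.\<close>

lemma dist_from_path:
  assumes r: "dist_from W E a r" and W: "W \<subseteq> verts G" and E: "E \<subseteq> edges G" and b: "b \<in> W"
    and a: "a \<in> W"
  obtains vs es where "path_between G a b vs es" "length es = r b" "set es \<subseteq> E"
proof -
  have "\<exists>vs es. walk G vs es \<and> set es \<subseteq> E \<and> set vs \<subseteq> W \<and> hd vs = a \<and> last vs = b \<and>
      length es = n \<and> (\<forall>i\<le>n. r (vs ! i) = i)" if "r b = n" "b \<in> W" for b n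
    using that
  proof (induction n arbitrary: b)
    case 0
    then have "b = a" using r by (auto simp: dist_from_def)
    then show ?case using a W r
      by (intro exI[of _ "[a]"] exI[of _ "[]"]) (auto simp: walk_def dist_from_def)
  next
    case (Suc n)
    then have "b \<noteq> a" using r a by (auto simp: dist_from_def)
    then obtain e w where e: "e \<in> E" "b \<in> e" "w \<in> e" "w \<in> W" "r b = r w + 1"
      using r Suc.prems by (auto simp: dist_from_def)
    then obtain vs es where p: "walk G vs es" "set es \<subseteq> E" "set vs \<subseteq> W" "hd vs = a"
      "last vs = w" "length es = n" "\<forall>i\<le>n. r (vs ! i) = i"
      using Suc.IH[of w] Suc.prems by auto
    have l: "length vs = Suc n" using p by (simp add: walk_def)
    then have ne: "vs \<noteq> []" by auto
    have lw: "vs ! n = w" using p(5) l last_conv_nth[OF ne] by simp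
    have "walk G (vs @ [b]) (es @ [e])"
      unfolding walk_def
    proof (intro conjI allI impI)
      fix i assume i: "i < length (es @ [e])"
      have "(vs @ [b]) ! i \<in> (es @ [e]) ! i \<and> (vs @ [b]) ! Suc i \<in> (es @ [e]) ! i \<and>
        (vs @ [b]) ! i \<noteq> (vs @ [b]) ! Suc i"
      proof (cases "i < n")
        case True
        then have "(vs @ [b]) ! i = vs ! i" "(vs @ [b]) ! Suc i = vs ! Suc i" "(es @ [e]) ! i = es ! i"
          using l p(6) by (simp_all add: nth_append)
        then show ?thesis using p(1,6) True unfolding walk_def by simp
      next
        case False
        then have "(vs @ [b]) ! i = w" "(vs @ [b]) ! Suc i = b" "(es @ [e]) ! i = e"
          using i l lw p(6) by (auto simp: nth_append less_Suc_eq)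
        then show ?thesis using e by auto
      qed
      then show "(vs @ [b]) ! i \<in> (es @ [e]) ! i" "(vs @ [b]) ! Suc i \<in> (es @ [e]) ! i"
        "(vs @ [b]) ! i \<noteq> (vs @ [b]) ! Suc i" by blast+
    qed (use p l e W E Suc.prems in \<open>auto simp: walk_def\<close>)
    moreover have "\<forall>i\<le>Suc n. r ((vs @ [b]) ! i) = i"
      using p(7) l Suc.prems by (auto simp: nth_append le_Suc_eq)
    ultimately show ?case using p e ne Suc.prems
      by (intro exI[of _ "vs @ [b]"] exI[of _ "es @ [e]"]) auto
  qed
  from this[OF refl b] obtain vs es where p: "walk G vs es" "set es \<subseteq> E" "set vs \<subseteq> W"
    "hd vs = a" "last vs = b" "length es = r b" "\<forall>i\<le>r b. r (vs ! i) = i"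
    by blast
  have l: "length vs = Suc (length es)" using p(1) by (simp add: walk_def)
  have "distinct vs"
    unfolding distinct_conv_nth using p(6,7) l by (metis less_Suc_eq_le)
  moreover have "distinct es"
  proof -
    have "es ! i \<noteq> es ! j" if ij: "i < j" "j < length es" for i j
    proof
      assume eq: "es ! i = es ! j"
      have "es ! j \<in> E" using ij p(2) by auto
      moreover have "vs ! i \<in> es ! j" "vs ! Suc j \<in> es ! j"
        using p(1) ij eq[symmetric] by (auto simp: walk_def)
      moreover have "vs ! i \<in> W" "vs ! Suc j \<in> W" using p(3) l ij by auto
      ultimately have "r (vs ! Suc j) \<le> r (vs ! i) + 1"
        using r unfolding dist_from_def by blast
      then show False using p(6,7) ij by simp
    qed
    then show ?thesis unfolding distinct_conv_nth by (metis nat_neq_iff)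
  qed
  ultimately show thesis using that p by (auto simp: path_between_def is_path_def)
qed

lemma dist_from_walk_le:
  assumes r: "dist_from (verts G) (edges G) a r" and p: "walk G vs es" and hd: "hd vs = a"
    and i: "i \<le> length es"
  shows "r (vs ! i) \<le> i"
  using i
proof (induction i)
  case 0
  have "vs \<noteq> []" using p by (auto simp: walk_def)
  then have "vs ! 0 = a" "a \<in> verts G" using hd p by (auto simp: hd_conv_nth walk_def)
  then show ?case using r by (auto simp: dist_from_def)
next
  case (Suc i)
  then have "es ! i \<in> edges G" "vs ! i \<in> es ! i" "vs ! Suc i \<in> es ! i"
    "vs ! i \<in> verts G" "vs ! Suc i \<in> verts G"
    using p unfolding walk_def by (auto simp: subset_iff)
  then have "r (vs ! Suc i) \<le> r (vs ! i) + 1" using r unfolding dist_from_def by blast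
  then show ?case using Suc by simp
qed

lemma hdist_eq_dist_from:
  assumes r: "dist_from (verts G) (edges G) a r" and ab: "a \<in> verts G" "b \<in> verts G"
  shows "hdist G a b = r b"
  unfolding hdist_def
proof (rule Least_equality)
  show "\<exists>vs es. path_between G a b vs es \<and> length es = r b"
    using dist_from_path[OF r order.refl order.refl ab(2,1)] by metis
next
  fix p assume "\<exists>vs es. path_between G a b vs es \<and> length es = p"
  then obtain vs es where p: "walk G vs es" "hd vs = a" "last vs = b" "length es = p"
    by (auto simp: path_between_def is_path_def)
  moreover have "vs \<noteq> []" using p(1) by (auto simp: walk_def)
  ultimately have "last vs = vs ! p" by (simp add: walk_def last_conv_nth)
  then show "r b \<le> p" using dist_from_walk_le[OF r p(1,2), of p] p by simp
qed

lemma path_between_rev: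
  assumes "path_between G u v vs es"
  shows "path_between G v u (rev vs) (rev es)"
proof -
  have p: "walk G vs es" "distinct vs" "distinct es" "hd vs = u" "last vs = v"
    using assms by (auto simp: path_between_def is_path_def)
  have l: "length vs = Suc (length es)" using p by (simp add: walk_def)
  have "walk G (rev vs) (rev es)"
    unfolding walk_def
  proof (intro conjI allI impI)
    fix i assume i: "i < length (rev es)"
    define j where "j = length es - Suc i"
    have j: "j < length es" "rev es ! i = es ! j" "rev vs ! i = vs ! Suc j" "rev vs ! Suc i = vs ! j"
      using i l by (auto simp: j_def rev_nth Suc_diff_Suc)
    show "rev vs ! i \<in> rev es ! i" "rev vs ! Suc i \<in> rev es ! i" "rev vs ! i \<noteq> rev vs ! Suc i"
      using p(1) j unfolding walk_def by metis+
  qed (use p in \<open>auto simp: walk_def\<close>)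
  then show ?thesis using p l by (auto simp: path_between_def is_path_def hd_rev last_rev)
qed

lemma hdist_sym: "hdist G u v = hdist G v u"
proof -
  have "(\<exists>vs es. path_between G u v vs es \<and> length es = p) \<longleftrightarrow>
    (\<exists>vs es. path_between G v u vs es \<and> length es = p)" for p
    using path_between_rev by (metis length_rev)
  then show ?thesis by (simp add: hdist_def)
qed

definition adjacency :: "'a set set \<Rightarrow> ('a \<times> 'a) set" where
  "adjacency E = {(a, b). \<exists>e\<in>E. a \<in> e \<and> b \<in> e}"

lemma dist_from_adjacency:
  "dist_from {b. (a, b) \<in> (adjacency E)\<^sup>*} E a (\<lambda>b. LEAST n. (a, b) \<in> adjacency E ^^ n)"
proof -
  define A where "A = adjacency E"
  define r where "r b = (LEAST n. (a, b) \<in> A ^^ n)" for b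
  have rI: "(a, b) \<in> A ^^ r b" if "(a, b) \<in> A\<^sup>*" for b
    using that unfolding r_def rtrancl_power by (rule LeastI_ex)
  have rle: "r b \<le> n" if "(a, b) \<in> A ^^ n" for b n
    using that unfolding r_def by (rule Least_le)
  have r0: "r b = 0 \<longleftrightarrow> b = a" if "(a, b) \<in> A\<^sup>*" for b
    using rI[OF that] rle[of a 0] by auto
  have lip: "r w' \<le> r w + 1" if "e \<in> E" "w \<in> e" "w' \<in> e" "(a, w) \<in> A\<^sup>*" for e w w'
  proof -
    have "(w, w') \<in> A" using that by (auto simp: A_def adjacency_def)
    then have "(a, w') \<in> A ^^ Suc (r w)" using rI[OF that(4)] by auto
    then show ?thesis using rle by fastforce
  qed
  have "\<exists>e\<in>E. b \<in> e \<and> (\<exists>w\<in>e \<inter> {b. (a, b) \<in> A\<^sup>*}. r b = r w + 1)"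
    if b: "(a, b) \<in> A\<^sup>*" "b \<noteq> a" for b
  proof -
    obtain n where n: "r b = Suc n" using r0[OF b(1)] b(2) not0_implies_Suc by blast
    then have "(a, b) \<in> A ^^ Suc n" using rI[OF b(1)] by simp
    then obtain w where w: "(a, w) \<in> A ^^ n" "(w, b) \<in> A" by auto
    then obtain e where e: "e \<in> E" "w \<in> e" "b \<in> e" by (auto simp: A_def adjacency_def)
    have aw: "(a, w) \<in> A\<^sup>*" using w(1) by (auto simp: rtrancl_power)
    have "r b = r w + 1" using lip[OF e aw] rle[OF w(1)] n by simp
    then show ?thesis using e aw by blast
  qed
  then have "dist_from {b. (a, b) \<in> A\<^sup>*} E a r"
    unfolding dist_from_def using r0 lip by auto
  then show ?thesis by (simp add: r_def[abs_def] A_def)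
qed

section \<open>Uniform hypertrees\<close>

text \<open>Hypertrees enter as connected hypergraphs with the right number of edges, together with
  their distance function.\<close>

locale utree =
  fixes V :: "'a set" and E :: "'a set set" and k :: nat and d :: "'a \<Rightarrow> 'a \<Rightarrow> nat"
  assumes fin: "finite V" and k2: "2 \<le> k"
    and edge_sub: "e \<in> E \<Longrightarrow> e \<subseteq> V" and edge_card: "e \<in> E \<Longrightarrow> card e = k"
    and count: "card V = 1 + (k - 1) * card E"
    and dist: "a \<in> V \<Longrightarrow> dist_from V E a (d a)"
begin

lemma finE: "finite E"
  using fin edge_sub by (meson Pow_iff finite_Pow_iff finite_subset subsetI)

lemma fin_edge: "e \<in> E \<Longrightarrow> finite e"
  using edge_sub fin finite_subset by blast

lemma edgeV: "e \<in> E \<Longrightarrow> w \<in> e \<Longrightarrow> w \<in> V"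
  using edge_sub by blast

lemma hdist: "a \<in> V \<Longrightarrow> b \<in> V \<Longrightarrow> hdist \<lparr>verts = V, edges = E\<rparr> a b = d a b"
  using hdist_eq_dist_from[of "\<lparr>verts = V, edges = E\<rparr>"] dist by simp

lemma dist_unique:
  "dist_from V E a r \<Longrightarrow> a \<in> V \<Longrightarrow> b \<in> V \<Longrightarrow> r b = d a b"
  using hdist_eq_dist_from[of "\<lparr>verts = V, edges = E\<rparr>" a r b] hdist by simp

lemma sym: "a \<in> V \<Longrightarrow> b \<in> V \<Longrightarrow> d a b = d b a"
  using hdist hdist_sym by metis

lemma d0: "a \<in> V \<Longrightarrow> b \<in> V \<Longrightarrow> d a b = 0 \<longleftrightarrow> a = b"
  using dist by (auto simp: dist_from_def)

lemma lip:
  assumes "a \<in> V" "e \<in> E" "w \<in> e" "w' \<in> e"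
  shows "d a w' \<le> d a w + 1"
proof -
  have "w \<in> e \<inter> V" "w' \<in> e \<inter> V" using assms edgeV by auto
  then show ?thesis using dist[OF assms(1)] assms(2) unfolding dist_from_def by blast
qed

lemma lip2: "a \<in> V \<Longrightarrow> e \<in> E \<Longrightarrow> w \<in> e \<Longrightarrow> w' \<in> e \<Longrightarrow> d w' a \<le> d w a + 1"
  using lip sym edgeV by metis

lemma descent:
  assumes "a \<in> V" "b \<in> V" "a \<noteq> b"
  obtains e w where "e \<in> E" "b \<in> e" "w \<in> e" "d a b = d a w + 1"
proof -
  have "\<exists>e\<in>E. b \<in> e \<and> (\<exists>w\<in>e \<inter> V. d a b = d a w + 1)"
    using dist[OF assms(1)] assms(2,3) unfolding dist_from_def by metis
  then show thesis using that by blast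
qed

lemma edge_ne: "e \<in> E \<Longrightarrow> e \<noteq> {}"
  using edge_card k2 by force

text \<open>Seen from \<open>a\<close>, every vertex but \<open>a\<close> is the farther end of some edge, while an edge has at
  most \<open>k - 1\<close> farther ends. As the vertices are counted exactly by the edges, both bounds are
  attained everywhere.\<close>

lemma tight:
  assumes a: "a \<in> V"
  shows "e \<in> E \<Longrightarrow> card {b \<in> e. \<exists>w\<in>e. d a b = d a w + 1} = k - 1"
    and "b \<in> V \<Longrightarrow> b \<noteq> a \<Longrightarrow> card {e \<in> E. b \<in> e \<and> (\<exists>w\<in>e. d a b = d a w + 1)} = 1"
proof -
  define R where "R b e \<longleftrightarrow> b \<in> e \<and> (\<exists>w\<in>e. d a b = d a w + 1)" for b e
  have le: "card {b \<in> V - {a}. R b e} \<le> k - 1" if e: "e \<in> E" for e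
  proof -
    obtain g where g: "g \<in> e" "\<And>w. w \<in> e \<Longrightarrow> d a g \<le> d a w"
      using arg_min_if_finite[OF fin_edge[OF e] edge_ne[OF e], of "d a"]
      by (metis not_le)
    have "{b \<in> V - {a}. R b e} \<subseteq> e - {g}" using g by (force simp: R_def)
    then have "card {b \<in> V - {a}. R b e} \<le> card (e - {g})"
      using fin_edge[OF e] by (intro card_mono) auto
    then show ?thesis using edge_card[OF e] g(1) by simp
  qed
  have ge: "1 \<le> card {e \<in> E. R b e}" if b: "b \<in> V - {a}" for b
  proof -
    obtain e w where "e \<in> E" "b \<in> e" "w \<in> e" "d a b = d a w + 1"
      using descent[OF a, of b] b by (metis DiffE insertI1)
    then have "e \<in> {e \<in> E. R b e}" unfolding R_def by blast
    then have "{e \<in> E. R b e} \<noteq> {}" by blast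
    then show ?thesis using finE by (simp add: Suc_le_eq card_gt_0_iff)
  qed
  have sw: "(\<Sum>b\<in>V - {a}. card {e \<in> E. R b e}) = (\<Sum>e\<in>E. card {b \<in> V - {a}. R b e})"
    using sum.swap_restrict[of "V - {a}" E "\<lambda>_ _. 1::nat" R] fin finE by simp
  have tot: "(\<Sum>b\<in>V - {a}. 1) = (\<Sum>e\<in>E. k - 1)"
    using fin a count by (simp add: mult.commute)
  show "card {b \<in> e. \<exists>w\<in>e. d a b = d a w + 1} = k - 1" if e: "e \<in> E"
  proof -
    have "card {b \<in> V - {a}. R b e} = k - 1"
    proof (rule ccontr)
      assume "card {b \<in> V - {a}. R b e} \<noteq> k - 1"
      then have "(\<Sum>e\<in>E. card {b \<in> V - {a}. R b e}) < (\<Sum>e\<in>E. k - 1)"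
        using e le finE by (intro sum_strict_mono_ex1) (auto simp: le_less)
      moreover have "(\<Sum>b\<in>V - {a}. 1) \<le> (\<Sum>b\<in>V - {a}. card {e \<in> E. R b e})"
        using ge by (rule sum_mono)
      ultimately show False using sw tot by linarith
    qed
    moreover have "{b \<in> V - {a}. R b e} = {b \<in> e. \<exists>w\<in>e. d a b = d a w + 1}"
      using edgeV[OF e] d0[OF a a] by (auto simp: R_def)
    ultimately show ?thesis by simp
  qed
  show "card {e \<in> E. b \<in> e \<and> (\<exists>w\<in>e. d a b = d a w + 1)} = 1" if b: "b \<in> V" "b \<noteq> a"
  proof (rule ccontr)
    assume "card {e \<in> E. b \<in> e \<and> (\<exists>w\<in>e. d a b = d a w + 1)} \<noteq> 1"
    then have "1 < card {e \<in> E. R b e}" using ge[of b] b by (simp add: R_def)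
    then have "(\<Sum>b\<in>V - {a}. 1) < (\<Sum>b\<in>V - {a}. card {e \<in> E. R b e})"
      using b ge fin by (intro sum_strict_mono_ex1 bexI[of _ b]) auto
    moreover have "(\<Sum>e\<in>E. card {b \<in> V - {a}. R b e}) \<le> (\<Sum>e\<in>E. k - 1)"
      using le by (rule sum_mono)
    ultimately show False using sw tot by linarith
  qed
qed

text \<open>Together with \<open>part_exists\<close> this is how acyclicity enters later: the parent
  edge of \<open>b\<close> seen from \<open>a\<close>, through which \<open>b\<close> is entered on
  the way from \<open>a\<close>, is determined.\<close>

lemma parent_unique:
  assumes "a \<in> V" "b \<in> V" "b \<noteq> a" "e \<in> E" "b \<in> e" "w \<in> e" "d a b = d a w + 1"
    "e' \<in> E" "b \<in> e'" "w' \<in> e'" "d a b = d a w' + 1"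
  shows "e = e'"
proof -
  obtain p where "{e \<in> E. b \<in> e \<and> (\<exists>w\<in>e. d a b = d a w + 1)} = {p}"
    using tight(2)[OF assms(1-3)] by (rule card_1_singletonE)
  moreover have "e \<in> {e \<in> E. b \<in> e \<and> (\<exists>w\<in>e. d a b = d a w + 1)}"
    using assms(4-7) by (intro CollectI conjI bexI[of _ w]) assumption+
  moreover have "e' \<in> {e \<in> E. b \<in> e \<and> (\<exists>w\<in>e. d a b = d a w + 1)}"
    using assms(8-11) by (intro CollectI conjI bexI[of _ w']) assumption+
  ultimately show ?thesis by (simp only: singleton_iff)
qed

subsection \<open>Parts of an edge\<close>

text \<open>For \<open>v\<close> in \<open>e\<close> this is the component of \<open>v\<close> after
  deleting \<open>e\<close>, namely the vertices whose nearest vertex in \<open>e\<close> is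
  \<open>v\<close>. Stating it by distances avoids following paths.\<close>

definition part :: "'a set \<Rightarrow> 'a \<Rightarrow> 'a set" where
  "part e v = {a \<in> V. \<forall>w\<in>e - {v}. d a w = d a v + 1}"

text \<open>By \<open>tight\<close> all but one of the vertices of \<open>e\<close> have a vertex of
  \<open>e\<close> one step nearer to \<open>a\<close>. The exception must be the nearest vertex
  \<open>g\<close>, and the others are then exactly one step beyond it.\<close>

lemma part_exists:
  assumes a: "a \<in> V" and e: "e \<in> E"
  obtains g where "g \<in> e" "a \<in> part e g"
proof -
  let ?P = "{b \<in> e. \<exists>w\<in>e. d a b = d a w + 1}"
  obtain g where g: "g \<in> e" "\<And>w. w \<in> e \<Longrightarrow> d a g \<le> d a w"
    using arg_min_if_finite[OF fin_edge[OF e] edge_ne[OF e], of "d a"]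
    by (metis not_le)
  have "?P \<subseteq> e - {g}" using g by force
  moreover have "card ?P = card (e - {g})"
    using tight(1)[OF a e] edge_card[OF e] g(1) by simp
  ultimately have P: "?P = e - {g}" using fin_edge[OF e] by (intro card_subset_eq) auto
  have "d a w = d a g + 1" if "w \<in> e - {g}" for w
  proof -
    obtain w' where "w' \<in> e" "d a w = d a w' + 1" using P \<open>w \<in> e - {g}\<close> by blast
    then show ?thesis using g(2)[of w'] lip[OF a e g(1), of w] that by simp
  qed
  then show thesis using that a g(1) by (simp add: part_def)
qed

lemma part_unique:
  assumes "a \<in> part e v" "a \<in> part e w" "v \<in> e" "w \<in> e"
  shows "v = w"
  using assms by (force simp: part_def)

lemma partD: "a \<in> part e v \<Longrightarrow> w \<in> e \<Longrightarrow> w \<noteq> v \<Longrightarrow> d a w = d a v + 1"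
  by (simp add: part_def)

lemma partV: "a \<in> part e v \<Longrightarrow> a \<in> V"
  by (simp add: part_def)

lemma part_self:
  assumes e: "e \<in> E" "v \<in> e"
  shows "v \<in> part e v"
proof -
  have v: "v \<in> V" using edgeV[OF e] .
  have "d v w = d v v + 1" if "w \<in> e - {v}" for w
    using lip[OF v e, of w] d0[OF v v] d0[OF v edgeV[OF e(1), of w]] that by auto
  then show ?thesis using v by (simp add: part_def)
qed

lemma adjacent_dist: "e \<in> E \<Longrightarrow> v \<in> e \<Longrightarrow> w \<in> e \<Longrightarrow> v \<noteq> w \<Longrightarrow> d v w = 1"
  using part_self[of e v] partD[of v e v w] d0 edgeV by fastforce

lemma not_partD:
  assumes "a \<in> V" "e \<in> E" "v \<in> e" "a \<notin> part e v"
  obtains g where "g \<in> e" "g \<noteq> v" "a \<in> part e g" "d a v = d a g + 1"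
  using part_exists[OF assms(1,2)] assms(3,4) partD by metis

lemma edge_within:
  assumes E: "e \<in> E" "f \<in> E" "e \<noteq> f" and v: "v \<in> f" and p: "p \<in> e" "p \<in> part f v" and q: "q \<in> e"
  shows "q \<in> part f v"
proof (rule ccontr)
  assume n: "q \<notin> part f v"
  have V: "p \<in> V" "q \<in> V" "v \<in> V" using edgeV E p q v by blast+
  obtain w where w: "w \<in> f" "w \<noteq> v" "q \<in> part f w" "d q v = d q w + 1"
    using not_partD[OF V(2) E(2) v n] .
  have wV: "w \<in> V" using w edgeV E by blast
  have 1: "d w p = d v p + 1" "d v q = d w q + 1"
    using partD[OF p(2) w(1,2)] w(4) sym V wV by auto
  have 2: "d v p = d w q" "d v q = d v p + 1"
    using 1 lip[OF V(3) E(1) p(1) q] lip[OF wV E(1) q p(1)] by auto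
  have vq: "q \<noteq> v" using 2 d0[OF V(3) V(3)] by auto
  show False
  proof (cases "q = w")
    case True
    have "d v q = d v v + 1" using adjacent_dist[OF E(2) v w(1)] w(2) True d0[OF V(3) V(3)] by auto
    then show False
      using parent_unique[OF V(3,2) vq E(1) q p(1) 2(2) E(2) _ v] True w(1) E(3) by blast
  next
    case False
    then obtain g z where g: "g \<in> E" "q \<in> g" "z \<in> g" "d w q = d w z + 1"
      using descent[OF wV V(2)] by metis
    have zV: "z \<in> V" using g edgeV by blast
    have "d v z \<le> d w z + 1" using lip2[OF zV E(2) w(1) v] .
    moreover have "d v q \<le> d v z + 1" using lip[OF V(3) g(1,3,2)] .
    ultimately have "d v q = d v z + 1" using 2 g(4) by linarith
    then have "g = e" using parent_unique[OF V(3,2) vq g(1,2,3) _ E(1) q p(1) 2(2)] by blast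
    then have "d w p \<le> d w z + 1" using lip[OF wV E(1) _ p(1)] g(3) by blast
    then show False using 1 2 g(4) by linarith
  qed
qed

lemma edge_within':
  assumes "e \<in> E" "f \<in> E" "e \<noteq> f" "v \<in> f" "v \<in> e"
  shows "e \<subseteq> part f v"
  using edge_within[OF assms(1-4,5) part_self[OF assms(2,4)]] by blast

lemma edge_inter: "e \<in> E \<Longrightarrow> f \<in> E \<Longrightarrow> e \<noteq> f \<Longrightarrow> v \<in> e \<Longrightarrow> v \<in> f \<Longrightarrow> w \<in> e \<Longrightarrow> w \<in> f \<Longrightarrow> v = w"
  using edge_within'[of e f v] part_self[of f w] part_unique[of w f v w] by blast

subsection \<open>Moving an edge\<close>

definition move :: "'a set \<Rightarrow> 'a \<Rightarrow> 'a \<Rightarrow> 'a set set" where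
  "move f v u = insert (insert u (f - {v})) (E - {f})"

text \<open>\<open>d v b\<close> already counts the step across \<open>f\<close>, so for
  \<open>b\<close> beyond \<open>v\<close> a shortest path to \<open>b\<close> changes only in
  ending its first stretch at \<open>u\<close> instead of \<open>v\<close>.\<close>

definition move_dist :: "'a set \<Rightarrow> 'a \<Rightarrow> 'a \<Rightarrow> 'a \<Rightarrow> 'a \<Rightarrow> nat" where
  "move_dist f v u a b =
     (if (a \<in> part f v) = (b \<in> part f v) then d a b
      else if a \<in> part f v then d a u + d v b else d a v + d u b)"

text \<open>By \<open>edge_within\<close> an edge other than \<open>f\<close> stays on one side of
  \<open>f\<close>, and there the new distance from \<open>a\<close> is an old distance from
  \<open>a\<close>, \<open>u\<close> or \<open>v\<close> plus a constant. Only the moved edge needs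
  its own computation. The case \<open>u = v\<close> is kept for
  \<open>dist_through\<close>.\<close>

lemma move_dist_from:
  assumes f: "f \<in> E" and v: "v \<in> f" and u: "u \<in> part f v" and a: "a \<in> V"
  shows "dist_from V (move f v u) a (move_dist f v u a)"
proof -
  let ?G = "part f v" and ?D = "move_dist f v u" and ?f = "insert u (f - {v})"
  have V: "u \<in> V" "v \<in> V" using edgeV f v partV[OF u] by auto
  have vG: "v \<in> ?G" using part_self f v .
  have fG: "w \<notin> ?G" if "w \<in> f" "w \<noteq> v" for w
    using that part_self[OF f that(1)] part_unique[of w f v w] v by blast
  have within: "(w \<in> ?G) = (w' \<in> ?G)" if "e \<in> E" "e \<noteq> f" "w \<in> e" "w' \<in> e" for e w w'
    using edge_within[OF that(1) f that(2) v] that by blast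
  have fd: "d v w = 1" if "w \<in> f" "w \<noteq> v" for w
    using adjacent_dist[OF f v that(1)] that by auto
  have z: "?D a b = 0 \<longleftrightarrow> b = a" if b: "b \<in> V" for b
    using d0[OF a b] d0[OF a V(1)] d0[OF V(2) b] d0[OF a V(2)] d0[OF V(1) b] u vG
    by (auto simp: move_dist_def)
  have lp: "?D a w' \<le> ?D a w + 1" if e: "e \<in> move f v u" and w: "w \<in> e" "w' \<in> e" for e w w'
  proof (cases "e \<in> E \<and> e \<noteq> f")
    case True
    then show ?thesis
      using within[of e w w'] w lip[OF a, of e w w'] lip[OF V(1), of e w w'] lip[OF V(2), of e w w']
      by (auto simp: move_dist_def)
  next
    case False
    then have ef: "e = ?f" using e by (auto simp: move_def)
    show ?thesis
    proof (cases "a \<in> ?G")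
      case True
      have "?D a x = d a u + (if x = u then 0 else 1)" if "x \<in> ?f" for x
        using that True u fG[of x] fd[of x] by (auto simp: move_dist_def)
      then show ?thesis using w ef by auto
    next
      case False
      then obtain g where g: "g \<in> f" "g \<noteq> v" "d a v = d a g + 1"
        using not_partD[OF a f v] by metis
      have "?D a x = (if x = u then d a v else d a x)" if "x \<in> ?f" for x
        using that False u fG[of x] d0[OF V(1) V(1)] by (auto simp: move_dist_def)
      then show ?thesis using w ef lip[OF a f] v by auto
    qed
  qed
  have ds: "\<exists>e\<in>move f v u. b \<in> e \<and> (\<exists>w\<in>e \<inter> V. ?D a b = ?D a w + 1)" if b: "b \<in> V" "b \<noteq> a" for b
  proof -
    have keep: "?thesis" if "e \<in> E" "e \<noteq> f" "b \<in> e" "w \<in> e" "?D a b = ?D a w + 1" for e w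
      using that edgeV by (intro bexI[of _ e]) (auto simp: move_def)
    have fin: "?thesis" if "b \<in> ?f" "w \<in> ?f" "?D a b = ?D a w + 1" for w
      using that edgeV[OF f] V by (intro bexI[of _ ?f]) (auto simp: move_def)
    consider "a \<in> ?G" "b \<in> ?G" | "a \<in> ?G" "b \<notin> ?G" | "a \<notin> ?G" "b \<notin> ?G" | "a \<notin> ?G" "b \<in> ?G"
      by blast
    then show ?thesis
    proof cases
      case 1
      obtain e w where e: "e \<in> E" "b \<in> e" "w \<in> e" "d a b = d a w + 1"
        using descent[OF a b(1)] b(2) by metis
      have "e \<noteq> f"
      proof
        assume "e = f"
        then have "b = v" using e(2) fG 1(2) by blast
        then show False using partD[OF 1(1), of w] e \<open>e = f\<close> by (cases "w = v") auto
      qed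
      then show ?thesis using keep[OF e(1) _ e(2,3)] e(4) 1 within[OF e(1) _ e(2,3)]
        by (auto simp: move_dist_def)
    next
      case 2
      have "b \<noteq> v" using 2 vG by blast
      then obtain e w where e: "e \<in> E" "b \<in> e" "w \<in> e" "d v b = d v w + 1"
        using descent[OF V(2) b(1)] by metis
      show ?thesis
      proof (cases "e = f")
        case True
        then have "?D a b = ?D a u + 1"
          using 2 u fd[of b] e \<open>b \<noteq> v\<close> by (auto simp: move_dist_def)
        then show ?thesis using fin[of u] e True \<open>b \<noteq> v\<close> by blast
      next
        case False
        then show ?thesis using keep[OF e(1) _ e(2,3)] e(4) 2 within[OF e(1) _ e(2,3)]
          by (auto simp: move_dist_def)
      qed
    next
      case 3
      obtain e w where e: "e \<in> E" "b \<in> e" "w \<in> e" "d a b = d a w + 1"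
        using descent[OF a b(1)] b(2) by metis
      show ?thesis
      proof (cases "e = f")
        case True
        have bv: "b \<noteq> v" using 3 vG by blast
        obtain g where g: "g \<in> f" "g \<noteq> v" "a \<in> part f g" "d a v = d a g + 1"
          using not_partD[OF a f v 3(1)] by metis
        have "w \<noteq> v"
          using partD[OF g(3), of b] e True g(4) by (cases "b = g") auto
        then have "?D a b = ?D a w + 1"
          using 3 e True fG[of w] by (auto simp: move_dist_def)
        then show ?thesis using fin[of w] e True bv \<open>w \<noteq> v\<close> by blast
      next
        case False
        then show ?thesis using keep[OF e(1) _ e(2,3)] e(4) 3 within[OF e(1) _ e(2,3)]
          by (auto simp: move_dist_def)
      qed
    next
      case 4
      show ?thesis
      proof (cases "b = u")
        case True
        obtain g where g: "g \<in> f" "g \<noteq> v" "a \<in> part f g" "d a v = d a g + 1"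
          using not_partD[OF a f v 4(1)] by metis
        have "?D a b = ?D a g + 1"
          using True 4 g fG[OF g(1,2)] d0[OF V(1) V(1)] by (auto simp: move_dist_def)
        then show ?thesis using fin[of g] True g by blast
      next
        case False
        then obtain e w where e: "e \<in> E" "b \<in> e" "w \<in> e" "d u b = d u w + 1"
          using descent[OF V(1) b(1)] by metis
        have "e \<noteq> f"
        proof
          assume "e = f"
          then have "b = v" using e(2) fG 4(2) by blast
          then show False using partD[OF u, of w] e \<open>e = f\<close> by (cases "w = v") auto
        qed
        then show ?thesis using keep[OF e(1) _ e(2,3)] e(4) 4 within[OF e(1) _ e(2,3)]
          by (auto simp: move_dist_def)
      qed
    qed
  qed
  show ?thesis
    unfolding dist_from_def
  proof (intro conjI ballI impI)
    show "move_dist f v u a b = 0 \<longleftrightarrow> b = a" if "b \<in> V" for b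
      using z[OF that] .
    show "?D a w' \<le> ?D a w + 1" if "e \<in> move f v u" "w \<in> e \<inter> V" "w' \<in> e \<inter> V" for e w w'
      using lp[OF that(1)] that(2,3) by blast
    show "\<exists>e\<in>move f v u. b \<in> e \<and> (\<exists>w\<in>e \<inter> V. ?D a b = ?D a w + 1)" if "b \<in> V" "b \<noteq> a" for b
      using ds[OF that] .
  qed
qed

text \<open>Moving an edge from \<open>v\<close> to \<open>v\<close> itself changes nothing, which turns the formula for the new
  distances into one for the old ones.\<close>

lemma dist_through:
  assumes f: "f \<in> E" "v \<in> f" and a: "a \<in> part f v" and b: "b \<in> V" "b \<notin> part f v"
  shows "d a b = d a v + d v b"
proof -
  have "move f v v = E" using f by (auto simp: move_def insert_absorb)
  then have "dist_from V E a (move_dist f v v a)"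
    using move_dist_from[OF f part_self[OF f] partV[OF a]] by simp
  from dist_unique[OF this partV[OF a] b(1)] show ?thesis
    using a b by (simp add: move_dist_def)
qed

text \<open>The vertices of \<open>f - {v}\<close> are at distance at least 2 from \<open>u\<close>,
  so none of them shares an edge with \<open>u\<close>. Hence a move keeps the number of
  edges.\<close>

lemma moved_edge_new:
  assumes f: "f \<in> E" "v \<in> f" and u: "u \<in> part f v" "u \<noteq> v"
  shows "insert u (f - {v}) \<notin> E" "u \<notin> f"
proof -
  show uf: "u \<notin> f" using part_self[OF f(1), of u] part_unique[OF u(1), of u] f u(2) by blast
  have "card (f - {v}) > 0" using edge_card[OF f(1)] f(2) k2 by simp
  then have "f - {v} \<noteq> {}" by (metis card.empty less_irrefl)
  then obtain w where w: "w \<in> f" "w \<noteq> v" by blast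
  have "d u w = d u v + 1" using partD[OF u(1) w] .
  moreover have "d u v \<noteq> 0" using d0[OF partV[OF u(1)] edgeV[OF f]] u(2) by blast
  moreover have "u \<noteq> w" using w uf by blast
  ultimately show "insert u (f - {v}) \<notin> E" using adjacent_dist[of "insert u (f - {v})" u w] w by auto
qed

lemma utree_move:
  assumes f: "f \<in> E" "v \<in> f" and u: "u \<in> part f v" "u \<noteq> v"
  shows "utree V (move f v u) k (move_dist f v u)"
proof
  have new: "insert u (f - {v}) \<notin> E" "u \<notin> f" using moved_edge_new[OF assms] .
  show "finite V" "2 \<le> k" by (rule fin, rule k2)
  show "e \<subseteq> V" if "e \<in> move f v u" for e
    using that edge_sub f partV[OF u(1)] by (auto simp: move_def)
  have "card (insert u (f - {v})) = k"
    using new f fin_edge[OF f(1)] edge_card[OF f(1)] k2 by simp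
  then show "card e = k" if "e \<in> move f v u" for e
    using that edge_card by (auto simp: move_def)
  have "0 < card E" using f finE by (auto simp: card_gt_0_iff)
  then have "card (move f v u) = card E"
    using new f finE by (simp add: move_def)
  then show "card V = 1 + (k - 1) * card (move f v u)" using count by simp
  show "dist_from V (move f v u) a (move_dist f v u a)" if "a \<in> V" for a
    using move_dist_from[OF f u(1) that] .
qed

subsection \<open>The effect of a move on the quadratic form\<close>

definition potential :: "('a \<Rightarrow> real) \<Rightarrow> 'a \<Rightarrow> real" where
  "potential x u = (\<Sum>b\<in>V. real (d u b) * x b)"

text \<open>Going from \<open>v\<close> to \<open>u\<close> brings \<open>part e u\<close> one step
  nearer, takes \<open>part e v\<close> one step farther away and leaves the distances to the other
  parts unchanged.\<close>

lemma potential_diff: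
  assumes e: "e \<in> E" "u \<in> e" "v \<in> e" "u \<noteq> v"
  shows "potential x u - potential x v = sum x (part e v) - sum x (part e u)"
proof -
  have V: "u \<in> V" "v \<in> V" using e edgeV by auto
  have pw: "real (d u b) * x b - real (d v b) * x b =
    (if b \<in> part e v then x b else 0) - (if b \<in> part e u then x b else 0)" if b: "b \<in> V" for b
  proof -
    obtain g where g: "g \<in> e" "b \<in> part e g" using part_exists[OF b e(1)] .
    have s: "d u b = d b u" "d v b = d b v" using sym V b by auto
    have iff: "b \<in> part e w \<longleftrightarrow> w = g" if "w \<in> e" for w
      using part_unique[OF _ g(2) that g(1)] g(2) by blast
    have "d b w = d b g + (if w = g then 0 else 1)" if "w \<in> e" for w
      using partD[OF g(2) that] by auto
    then show ?thesis using iff s e by (auto simp: algebra_simps)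
  qed
  have "potential x u - potential x v =
    (\<Sum>b\<in>V. (if b \<in> part e v then x b else 0) - (if b \<in> part e u then x b else 0))"
    unfolding potential_def sum_subtractf[symmetric] by (rule sum.cong) (simp_all only: pw)
  also have "\<dots> = sum x (V \<inter> part e v) - sum x (V \<inter> part e u)"
    unfolding sum_subtractf by (simp add: sum.inter_restrict[OF fin])
  finally show ?thesis by (metis Int_absorb1 partV subsetI)
qed

text \<open>Only pairs separated by \<open>f\<close> are affected. For \<open>a\<close> on the side
  of \<open>v\<close> the change is \<open>d u a - d v a\<close>, independent of the vertex beyond
  \<open>v\<close>, so the double sum factors.\<close>

lemma quad_move:
  assumes f: "f \<in> E" "v \<in> f" and u: "u \<in> part f v"
  shows "quad V (\<lambda>a b. real (move_dist f v u a b)) y =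
    quad V (\<lambda>a b. real (d a b)) y +
    2 * sum y (V - part f v) * (\<Sum>b\<in>part f v. (real (d u b) - real (d v b)) * y b)"
proof -
  let ?G = "part f v"
  define p where "p b = real (d u b) - real (d v b)" for b
  define g c :: "'a \<Rightarrow> real" where "g b = of_bool (b \<in> ?G)" and "c b = of_bool (b \<notin> ?G)" for b
  have V: "u \<in> V" "v \<in> V" using partV[OF u] edgeV[OF f] .
  have pw: "real (move_dist f v u a b) = real (d a b) + g a * c b * p a + c a * g b * p b"
    if ab: "a \<in> V" "b \<in> V" for a b
  proof -
    have s: "d a u = d u a" "d a v = d v a" "d a b = d b a" "d b v = d v b" using sym V ab by auto
    consider "a \<in> ?G" "b \<notin> ?G" | "a \<notin> ?G" "b \<in> ?G" | "(a \<in> ?G) = (b \<in> ?G)" by blast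
    then show ?thesis
    proof cases
      case 1
      then show ?thesis using dist_through[OF f 1(1) ab(2) 1(2)] s
        by (simp add: move_dist_def g_def c_def p_def)
    next
      case 2
      then show ?thesis using dist_through[OF f 2(2) ab(1) 2(1)] s
        by (simp add: move_dist_def g_def c_def p_def)
    next
      case 3
      then show ?thesis by (simp add: move_dist_def g_def c_def)
    qed
  qed
  have C: "(\<Sum>b\<in>V. c b * y b) = sum y (V - ?G)"
    by (rule sum.mono_neutral_cong_right) (auto simp: fin c_def)
  have G: "(\<Sum>b\<in>V. g b * p b * y b) = (\<Sum>b\<in>?G. p b * y b)"
    by (rule sum.mono_neutral_cong_right) (auto simp: fin g_def dest: partV)
  have "quad V (\<lambda>a b. real (move_dist f v u a b)) y =
    (\<Sum>a\<in>V. \<Sum>b\<in>V. (real (d a b) + g a * c b * p a + c a * g b * p b) * y a * y b)"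
    unfolding quad_def by (intro sum.cong refl) (simp add: pw)
  also have "\<dots> = quad V (\<lambda>a b. real (d a b)) y
      + (\<Sum>a\<in>V. \<Sum>b\<in>V. (g a * p a * y a) * (c b * y b))
      + (\<Sum>a\<in>V. \<Sum>b\<in>V. (c a * y a) * (g b * p b * y b))"
    unfolding quad_def sum.distrib[symmetric] by (intro sum.cong refl) (simp add: algebra_simps)
  also have "(\<Sum>a\<in>V. \<Sum>b\<in>V. (g a * p a * y a) * (c b * y b)) =
      (\<Sum>b\<in>?G. p b * y b) * sum y (V - ?G)"
    unfolding sum_product[symmetric] C G ..
  also have "(\<Sum>a\<in>V. \<Sum>b\<in>V. (c a * y a) * (g b * p b * y b)) =
      sum y (V - ?G) * (\<Sum>b\<in>?G. p b * y b)"
    unfolding sum_product[symmetric] C G ..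
  finally show ?thesis by (simp add: p_def)
qed

text \<open>Over all of \<open>V\<close> the sum is the difference of potentials, and each vertex
  beyond \<open>v\<close> is reached from \<open>u\<close> through \<open>v\<close>, contributing
  \<open>d u v\<close> times its weight.\<close>

lemma sum_part_potential:
  assumes f: "f \<in> E" "v \<in> f" and u: "u \<in> part f v"
  shows "(\<Sum>b\<in>part f v. (real (d u b) - real (d v b)) * x b) =
    potential x u - potential x v - sum x (V - part f v) * real (d u v)"
proof -
  let ?h = "\<lambda>b. (real (d u b) - real (d v b)) * x b"
  have "part f v \<subseteq> V" using partV by blast
  then have "sum ?h V = sum ?h (V - part f v) + sum ?h (part f v)"
    by (rule sum.subset_diff[OF _ fin])
  moreover have "sum ?h V = potential x u - potential x v"
    by (simp add: potential_def sum_subtractf left_diff_distrib)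
  moreover have "sum ?h (V - part f v) = sum x (V - part f v) * real (d u v)"
    unfolding sum_distrib_right
  proof (rule sum.cong[OF refl])
    fix b assume "b \<in> V - part f v"
    then have "d u b = d u v + d v b" using dist_through[OF f u] by blast
    then show "?h b = x b * real (d u v)" by simp
  qed
  ultimately show ?thesis by linarith
qed

lemma quad_add:
  "quad V (\<lambda>a b. real (d a b)) (\<lambda>a. x a + z a) = quad V (\<lambda>a b. real (d a b)) x
    + 2 * (\<Sum>a\<in>V. potential x a * z a) + (\<Sum>a\<in>V. potential z a * z a)"
proof -
  have "(\<Sum>a\<in>V. \<Sum>b\<in>V. real (d a b) * x a * z b) = (\<Sum>b\<in>V. \<Sum>a\<in>V. real (d b a) * x a * z b)"
    by (subst sum.swap, intro sum.cong refl) (simp add: sym)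
  then have c: "(\<Sum>a\<in>V. \<Sum>b\<in>V. real (d a b) * x a * z b) = (\<Sum>a\<in>V. potential x a * z a)"
    by (simp add: potential_def sum_distrib_right)
  show ?thesis
    using c by (simp add: quad_def potential_def algebra_simps sum.distrib sum_distrib_left sum_distrib_right)
qed

text \<open>The moved edge carries the weight \<open>c\<close> of the vertices beyond \<open>v\<close>. If \<open>x u - x v \<ge> c\<close> the
  vector \<open>x\<close> itself witnesses the increase, otherwise \<open>x\<close> with its values at \<open>u\<close> and \<open>v\<close> exchanged.\<close>

lemma move_increases_quad:
  assumes f: "f \<in> E" "v \<in> f" and u: "u \<in> part f v" "u \<noteq> v"
    and pos: "\<And>a. a \<in> V \<Longrightarrow> 0 < x a"
    and eig: "\<And>a. a \<in> V \<Longrightarrow> potential x a = \<rho> * x a"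
    and big: "real (d u v) < \<rho>"
    and K: "potential x u - potential x v > real (d u v) * (x v + sum x (V - part f v) - x u)"
  obtains y where "sqn V y = sqn V x"
    "quad V (\<lambda>a b. real (d a b)) x < quad V (\<lambda>a b. real (move_dist f v u a b)) y"
proof -
  let ?Q = "quad V (\<lambda>a b. real (d a b))" and ?Q' = "quad V (\<lambda>a b. real (move_dist f v u a b))"
  have V: "u \<in> V" "v \<in> V" using partV[OF u(1)] edgeV[OF f] .
  define c where "c = sum x (V - part f v)"
  define s where "s = x u - x v"
  define D where "D = real (d u v)"
  define P where "P = potential x u - potential x v"
  have P: "P = \<rho> * s" using eig V by (simp add: P_def s_def algebra_simps)
  have D: "D \<ge> 0" by (simp add: D_def)
  have "\<exists>w\<in>f. w \<noteq> v"
  proof (rule ccontr)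
    assume "\<not> ?thesis"
    then have "f = {v}" using f by blast
    then show False using edge_card[OF f(1)] k2 by simp
  qed
  then obtain w where w: "w \<in> f" "w \<noteq> v" by blast
  have "w \<notin> part f v" using part_unique[of w f v w] part_self[OF f(1) w(1)] f w by blast
  then have "w \<in> V - part f v" using edgeV[OF f(1) w(1)] by blast
  then have c: "0 < c" unfolding c_def using pos fin by (intro sum_pos) auto
  show thesis
  proof (cases "s \<ge> c")
    case True
    have "?Q' x = ?Q x + 2 * c * (P - c * D)"
      unfolding quad_move[OF f u(1)] sum_part_potential[OF f u(1)] c_def P_def D_def ..
    moreover have "c * D < P"
    proof -
      have "c * D < c * \<rho>" using c big by (simp add: D_def)
      also have "\<dots> \<le> s * \<rho>" using True big D by (intro mult_right_mono) (auto simp: D_def)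
      finally show ?thesis by (simp add: P mult.commute)
    qed
    ultimately show thesis using that[of x] c by simp
  next
    case False
    \<comment> \<open>Writing the exchange of the two values as an additive perturbation
      \<open>z\<close> lets \<open>quad_add\<close> expand the form.\<close>
    define z where "z b = s * (of_bool (b = v) - of_bool (b = u))" for b
    define y where "y b = x b + z b" for b
    have yv: "y v = x u" "y u = x v" using u(2) by (auto simp: y_def z_def s_def)
    have sz: "(\<Sum>b\<in>V. h b * z b) = s * (h v - h u)" for h
    proof -
      have "(\<Sum>b\<in>V. h b * z b) = (\<Sum>b\<in>V. if b = v then s * h b else 0) - (\<Sum>b\<in>V. if b = u then s * h b else 0)"
        unfolding z_def sum_subtractf[symmetric] by (intro sum.cong) auto
      then show ?thesis using fin V by (simp add: algebra_simps)
    qed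
    have vG: "v \<in> part f v" using part_self[OF f] .
    have sy: "sum y (V - part f v) = c"
      unfolding c_def by (rule sum.cong) (use vG u in \<open>auto simp: y_def z_def\<close>)
    have pz: "potential z a = s * (real (d a v) - real (d a u))" for a
      unfolding potential_def by (rule sz)
    have "potential z v - potential z u = - 2 * s * D"
      using d0[OF V(1,1)] d0[OF V(2,2)] sym[OF V] by (simp add: pz D_def algebra_simps)
    then have zz: "(\<Sum>a\<in>V. potential z a * z a) = - 2 * s^2 * D"
      unfolding sz by (simp add: power2_eq_square)
    have Qy: "?Q y = ?Q x - 2 * s * P - 2 * s^2 * D"
      using quad_add[of x z] sz[of "potential x"] zz by (simp add: y_def[abs_def] P_def algebra_simps)
    have pot_y: "potential y u - potential y v = P + 2 * s * D"
    proof -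
      have py: "potential y a = potential x a + s * (real (d a v) - real (d a u))" for a
        using sz[of "\<lambda>b. real (d a b)"] by (simp add: potential_def y_def sum.distrib algebra_simps)
      then show ?thesis using d0[OF V(1,1)] d0[OF V(2,2)] sym[OF V] by (simp add: py P_def D_def algebra_simps)
    qed
    have "?Q' y = ?Q y + 2 * c * (P + 2 * s * D - c * D)"
      unfolding quad_move[OF f u(1)] sum_part_potential[OF f u(1)] sy pot_y D_def ..
    \<comment> \<open>The loss \<open>- 2 * s * P - 2 * s^2 * D\<close> caused by the exchange
      combines with the gain of the move into a product. Its first factor is positive in this case,
      and its second is positive by \<open>K\<close>, whose right-hand side is
      \<open>D * (c - s)\<close>.\<close>
    also have "\<dots> = ?Q x + 2 * ((c - s) * (P - D * (c - s)))"
      unfolding Qy by (simp add: power2_eq_square algebra_simps)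
    finally have "?Q' y = \<dots>" .
    moreover have "P > D * (c - s)" using K by (simp add: P_def D_def c_def s_def algebra_simps)
    then have "(c - s) * (P - D * (c - s)) > 0" using False by simp
    ultimately have "?Q x < ?Q' y" by linarith
    moreover have "sqn V y = sqn V x"
    proof -
      have "(y b)^2 = (x b)^2 + (x u + x v) * z b" for b
        using u(2) by (auto simp: y_def z_def s_def power2_eq_square algebra_simps)
      then have "sqn V y = sqn V x + (\<Sum>b\<in>V. (x u + x v) * z b)"
        by (simp add: sqn_def sum.distrib)
      then show ?thesis using sz[of "\<lambda>_. x u + x v"] by simp
    qed
    ultimately show thesis using that by blast
  qed
qed

subsection \<open>The distance spectral radius\<close>

abbreviation radius :: real where
  "radius \<equiv> distance_spectral_radius \<lparr>verts = V, edges = E\<rparr>"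

lemma card_ge2: "E \<noteq> {} \<Longrightarrow> 2 \<le> card V"
  using count k2 finE by (cases "card E") (auto simp: card_gt_0_iff)

lemma quad_hdist: "quad V (\<lambda>a b. real (hdist \<lparr>verts = V, edges = E\<rparr> a b)) y = quad V (\<lambda>a b. real (d a b)) y"
  unfolding quad_def by (intro sum.cong refl) (simp add: hdist)

lemma perron:
  assumes E: "E \<noteq> {}"
  obtains x where "\<And>a. a \<in> V \<Longrightarrow> 0 < x a" "\<And>a. a \<in> V \<Longrightarrow> potential x a = radius * x a"
    "\<And>y. quad V (\<lambda>a b. real (d a b)) y \<le> radius * sqn V y"
proof -
  let ?G = "\<lparr>verts = V, edges = E\<rparr>"
  have p: "0 < hdist ?G a b" if "a \<in> verts ?G" "b \<in> verts ?G" "a \<noteq> b" for a b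
    using that hdist d0 by fastforce
  obtain x where x: "\<And>v. v \<in> verts ?G \<Longrightarrow> 0 < x v"
    "\<And>u. u \<in> verts ?G \<Longrightarrow> (\<Sum>v\<in>verts ?G. real (hdist ?G u v) * x v) = radius * x u"
    "\<And>y. quad (verts ?G) (\<lambda>a b. real (hdist ?G a b)) y \<le> radius * sqn (verts ?G) y"
    using distance_spectral_radius_perron[of ?G, OF _ _ hdist_sym p] fin card_ge2[OF E] by auto
  have "potential x u = radius * x u" if "u \<in> V" for u
    using x(2)[of u] that by (simp add: potential_def hdist)
  then show thesis using that[of x] x quad_hdist by auto
qed

text \<open>Rayleigh quotient of the constant vector, whose row sums are at least
  \<open>card V - 1\<close>. It serves to put the radius above the distances over which edges are
  moved.\<close>

lemma radius_ge:
  assumes E: "E \<noteq> {}"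
  shows "real (card V) - 1 \<le> radius"
proof -
  obtain x where x: "\<And>y. quad V (\<lambda>a b. real (d a b)) y \<le> radius * sqn V y"
    using perron[OF E] by metis
  have c: "0 < card V" using count by simp
  have "(\<Sum>b\<in>V. real (d a b)) \<ge> real (card V) - 1" if a: "a \<in> V" for a
  proof -
    have "real (card V) - 1 = (\<Sum>b\<in>V - {a}. 1)"
      using a fin c by (simp add: of_nat_diff)
    also have "\<dots> \<le> (\<Sum>b\<in>V - {a}. real (d a b))"
    proof (rule sum_mono)
      fix b assume "b \<in> V - {a}"
      then have "d a b \<noteq> 0" using d0[OF a] by auto
      then show "1 \<le> real (d a b)" by simp
    qed
    also have "\<dots> \<le> (\<Sum>b\<in>V. real (d a b))" by (rule sum_mono2) (use fin in auto)
    finally show ?thesis .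
  qed
  then have "(\<Sum>a\<in>V. real (card V) - 1) \<le> quad V (\<lambda>a b. real (d a b)) (\<lambda>_. 1)"
    unfolding quad_def mult_1_right by (rule sum_mono)
  also have "\<dots> \<le> radius * real (card V)" using x[of "\<lambda>_. 1"] by (simp add: sqn_def)
  finally have "real (card V) * (real (card V) - 1) \<le> real (card V) * radius" by (simp add: mult.commute)
  then show ?thesis using c by simp
qed

lemma radius_less_move:
  assumes f: "f \<in> E" "v \<in> f" and u: "u \<in> part f v" "u \<noteq> v"
    and pos: "\<And>a. a \<in> V \<Longrightarrow> 0 < x a"
    and eig: "\<And>a. a \<in> V \<Longrightarrow> potential x a = radius * x a"
    and big: "real (d u v) < radius"
    and K: "potential x u - potential x v > real (d u v) * (x v + sum x (V - part f v) - x u)"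
  shows "radius < distance_spectral_radius \<lparr>verts = V, edges = move f v u\<rparr>"
proof -
  interpret M: utree V "move f v u" k "move_dist f v u" by (rule utree_move[OF f u])
  have "move f v u \<noteq> {}" by (simp add: move_def)
  then have le: "quad V (\<lambda>a b. real (move_dist f v u a b)) y \<le> M.radius * sqn V y" for y
    using M.perron by metis
  obtain y where y: "sqn V y = sqn V x"
    "quad V (\<lambda>a b. real (d a b)) x < quad V (\<lambda>a b. real (move_dist f v u a b)) y"
    using move_increases_quad[OF f u pos eig big K] .
  have "quad V (\<lambda>a b. real (d a b)) x = (\<Sum>a\<in>V. potential x a * x a)"
    by (simp add: quad_def potential_def sum_distrib_left mult_ac)
  also have "\<dots> = radius * sqn V x"
    by (simp add: eig sqn_def sum_distrib_left power2_eq_square mult_ac)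
  finally have "radius * sqn V x < M.radius * sqn V x"
    using y le[of y] by simp
  moreover have "0 < sqn V x"
    using sqn_pos[OF fin edgeV[OF f], of x] pos[OF edgeV[OF f]] by simp
  ultimately show ?thesis by simp
qed

end

section \<open>Branching\<close>

definition junction :: "'a set set \<Rightarrow> 'a set \<Rightarrow> 'a \<Rightarrow> bool" where
  "junction E e v \<longleftrightarrow> v \<in> e \<and> (\<exists>f\<in>E. f \<noteq> e \<and> v \<in> f)"

definition branching_vertex :: "'a set set \<Rightarrow> 'a \<Rightarrow> bool" where
  "branching_vertex E v \<longleftrightarrow>
     (\<exists>e\<in>E. \<exists>f\<in>E. \<exists>g\<in>E. e \<noteq> f \<and> e \<noteq> g \<and> f \<noteq> g \<and> v \<in> e \<and> v \<in> f \<and> v \<in> g)"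

definition branching_edge :: "'a set set \<Rightarrow> 'a set \<Rightarrow> bool" where
  "branching_edge E e \<longleftrightarrow>
     (\<exists>u v w. u \<noteq> v \<and> u \<noteq> w \<and> v \<noteq> w \<and> junction E e u \<and> junction E e v \<and> junction E e w)"

definition branching :: "'a set set \<Rightarrow> bool" where
  "branching E \<longleftrightarrow> (\<exists>v. branching_vertex E v) \<or> (\<exists>e\<in>E. branching_edge E e)"

lemma junctionI: "v \<in> e \<Longrightarrow> f \<in> E \<Longrightarrow> f \<noteq> e \<Longrightarrow> v \<in> f \<Longrightarrow> junction E e v"
  unfolding junction_def by blast

lemma junctionE:
  assumes "junction E e v"
  obtains f where "v \<in> e" "f \<in> E" "f \<noteq> e" "v \<in> f"
  using assms unfolding junction_def by blast

lemma branching_vertexI: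
  "e \<in> E \<Longrightarrow> f \<in> E \<Longrightarrow> g \<in> E \<Longrightarrow> e \<noteq> f \<Longrightarrow> e \<noteq> g \<Longrightarrow> f \<noteq> g \<Longrightarrow> v \<in> e \<Longrightarrow> v \<in> f \<Longrightarrow> v \<in> g
    \<Longrightarrow> branching E"
  unfolding branching_def branching_vertex_def by blast

lemma branching_edgeI:
  "e \<in> E \<Longrightarrow> u \<noteq> v \<Longrightarrow> u \<noteq> w \<Longrightarrow> v \<noteq> w \<Longrightarrow> junction E e u \<Longrightarrow> junction E e v \<Longrightarrow> junction E e w
    \<Longrightarrow> branching E"
  unfolding branching_def branching_edge_def by blast

lemma junction_mono: "junction E' e v \<Longrightarrow> E' \<subseteq> E \<Longrightarrow> junction E e v"
  unfolding junction_def by blast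

lemma branching_mono:
  assumes "branching E'" "E' \<subseteq> E"
  shows "branching E"
  using assms(1) unfolding branching_def
proof (elim disjE exE bexE)
  fix v assume "branching_vertex E' v"
  then have "branching_vertex E v" unfolding branching_vertex_def using assms(2) by (meson subsetD)
  then show "(\<exists>v. branching_vertex E v) \<or> (\<exists>e\<in>E. branching_edge E e)" by blast
next
  fix e assume "e \<in> E'" "branching_edge E' e"
  then have "e \<in> E" "branching_edge E e"
    unfolding branching_edge_def using assms(2) junction_mono by (blast, meson)
  then show "(\<exists>v. branching_vertex E v) \<or> (\<exists>e\<in>E. branching_edge E e)" by blast
qed

context utree
begin

section \<open>Edges and branches around a junction\<close>

lemma move_keep: "e \<in> E \<Longrightarrow> e \<noteq> f \<Longrightarrow> e \<in> move f v u"
  by (simp add: move_def)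

lemma move_new: "insert u (f - {v}) \<in> move f v u"
  by (simp add: move_def)

lemma Diff_subset_move: "E - {f} \<subseteq> move f v u"
  by (auto simp: move_def)

lemma edge_other_vertex:
  assumes "e \<in> E"
  obtains u where "u \<in> e" "u \<noteq> v"
proof -
  have "e \<noteq> {}" "e \<noteq> {v}" using edge_card[OF assms] k2 by auto
  then show thesis using that by blast
qed

lemma edge_two_other_vertices:
  assumes "e \<in> E" "3 \<le> k"
  obtains u w where "u \<in> e" "w \<in> e" "u \<noteq> v" "w \<noteq> v" "u \<noteq> w"
proof -
  obtain u where u: "u \<in> e" "u \<noteq> v" using edge_other_vertex[OF assms(1)] .
  have "card {u, v} \<le> 2" by (simp add: card_insert_if)
  then have "\<not> e \<subseteq> {u, v}"
    using card_mono[of "{u, v}" e] edge_card[OF assms(1)] assms(2) by auto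
  then show thesis using that u by blast
qed

lemma part_sub_beyond:
  assumes e: "e \<in> E" "v \<in> e" "u \<in> e" "u \<noteq> v"
  shows "part e u \<subseteq> V - part e v"
  using part_unique[of _ e u v] e partV by blast

text \<open>Otherwise both \<open>e\<close> and \<open>f\<close> would be the parent edge of
  \<open>v\<close> seen from \<open>a\<close>.\<close>

lemma beyond_disjoint:
  assumes e: "e \<in> E" "f \<in> E" "e \<noteq> f" "v \<in> e" "v \<in> f" and a: "a \<in> V - part e v"
  shows "a \<in> part f v"
proof (rule ccontr)
  assume n: "a \<notin> part f v"
  have V: "a \<in> V" "v \<in> V" using a e edgeV by auto
  have va: "v \<noteq> a" using a part_self[OF e(1,4)] by blast
  obtain g where g: "g \<in> e" "d a v = d a g + 1" using not_partD[OF V(1) e(1,4)] a by blast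
  obtain h where h: "h \<in> f" "d a v = d a h + 1" using not_partD[OF V(1) e(2,5) n] by blast
  show False using parent_unique[OF V va e(1,4) g e(2,5) h] e(3) by blast
qed

lemma part_no_parent:
  assumes "a \<in> part e v" "w \<in> f" "d a v = d a w + 1"
  shows "f \<noteq> e"
proof
  assume "f = e"
  moreover have "w \<noteq> v" using assms(3) by auto
  ultimately have "d a w = d a v + 1" using partD assms(1,2) by blast
  then show False using assms(3) by simp
qed

lemma part_leaf:
  assumes e: "e \<in> E" "u \<in> e" and l: "\<not> junction E e u"
  shows "part e u = {u}"
proof -
  have "a = u" if a: "a \<in> part e u" for a
  proof (rule ccontr)
    assume "a \<noteq> u"
    then obtain f w where f: "f \<in> E" "u \<in> f" "w \<in> f" "d a u = d a w + 1"
      using descent[OF partV[OF a] edgeV[OF e]] by metis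
    have "f \<noteq> e" using part_no_parent[OF a f(3,4)] .
    then show False using l e(2) f junctionI by metis
  qed
  then show ?thesis using part_self[OF e] by blast
qed

text \<open>The parent edge of \<open>v\<close> seen from another vertex of \<open>part e v\<close>
  is not \<open>e\<close>, so it is \<open>f\<close>, and that vertex lies beyond \<open>v\<close>
  across \<open>f\<close>.\<close>

lemma part_two_edges:
  assumes e: "e \<in> E" "f \<in> E" "e \<noteq> f" "v \<in> e" "v \<in> f"
    and only: "\<And>g. g \<in> E \<Longrightarrow> v \<in> g \<Longrightarrow> g = e \<or> g = f"
  shows "part e v = insert v (V - part f v)"
proof -
  have "a \<notin> part f v" if a: "a \<in> part e v" "a \<noteq> v" for a
  proof -
    obtain g w where g: "g \<in> E" "v \<in> g" "w \<in> g" "d a v = d a w + 1"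
      using descent[OF partV[OF a(1)] edgeV[OF e(1,4)] a(2)] .
    have "g \<noteq> e" using part_no_parent[OF a(1) g(3,4)] .
    then have "g = f" using only g by blast
    then show ?thesis using part_no_parent[OF _ g(3,4)] by blast
  qed
  then show ?thesis
    using beyond_disjoint[OF e(2,1) e(3)[symmetric] e(5,4)] part_self[OF e(1,4)] partV by blast
qed

text \<open>The vertex \<open>u\<close> lies in \<open>e\<close> and in a further edge; the moved
  edge becomes the third one there.\<close>

lemma branching_move_junction:
  assumes e: "e \<in> E" "f \<in> E" "e \<noteq> f" "v \<in> e" "v \<in> f" and u: "junction E e u" "u \<noteq> v"
  shows "branching (move f v u)"
proof -
  obtain h where h: "u \<in> e" "h \<in> E" "h \<noteq> e" "u \<in> h" using junctionE[OF u(1)] .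
  have uf: "u \<in> part f v" using edge_within'[OF e(1,2,3,5,4)] h(1) by blast
  have new: "insert u (f - {v}) \<notin> E" "u \<notin> f" using moved_edge_new[OF e(2,5) uf u(2)] .
  show ?thesis
    by (rule branching_vertexI[OF move_keep[OF e(1,3)] move_keep[OF h(2)] move_new])
      (use new h e in blast)+
qed

text \<open>With \<open>k >= 3\<close> there are two vertices besides \<open>v\<close>, and only one
  of them can be a junction. Such a vertex is a place to attach an edge without adding the weight of
  a branch. This is where ordinary trees behave differently.\<close>

lemma branching_edge_exists_leaf:
  assumes e: "e \<in> E" "junction E e v" and k: "3 \<le> k" and nb: "\<not> branching_edge E e"
  obtains y where "y \<in> e" "y \<noteq> v" "\<not> junction E e y"
proof -
  obtain u w where u: "u \<in> e" "w \<in> e" "u \<noteq> v" "w \<noteq> v" "u \<noteq> w"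
    using edge_two_other_vertices[OF e(1) k] .
  then have "\<not> (junction E e u \<and> junction E e w)"
    using nb e(2) unfolding branching_edge_def by metis
  then show thesis using that u by blast
qed

end

section \<open>Maximisers of the distance spectral radius\<close>

text \<open>Since competitors are restricted to branching edge sets on the same vertices, a move
  that would increase the radius is not contradictory in itself; it must destroy branching.\<close>

locale maximal_utree = utree V E k d
  for V :: "'a set" and E k d +
  fixes x :: "'a \<Rightarrow> real"
  assumes pos: "a \<in> V \<Longrightarrow> 0 < x a"
    and eig: "a \<in> V \<Longrightarrow> potential x a = radius * x a"
    and four: "4 \<le> card E"
    and maximal: "utree V E' k d' \<Longrightarrow> branching E' \<Longrightarrow>
      distance_spectral_radius \<lparr>verts = V, edges = E'\<rparr> \<le> radius"
begin

text \<open>The weight of the branch that leaves \<open>v\<close> through \<open>e\<close>, without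
  \<open>v\<close> itself.\<close>

definition beyond :: "'a set \<Rightarrow> 'a \<Rightarrow> real" where
  "beyond e v = sum x (V - part e v)"

lemma radius_gt: "2 < radius"
proof -
  have "E \<noteq> {}" using four by auto
  moreover have "1 * 4 \<le> (k - 1) * card E" using k2 four by (intro mult_mono) auto
  then have "5 \<le> card V" using count by simp
  ultimately show ?thesis using radius_ge by fastforce
qed

lemma sum_mono_pos: "A \<subseteq> B \<Longrightarrow> B \<subseteq> V \<Longrightarrow> sum x A \<le> sum x B"
  using pos fin finite_subset by (intro sum_mono2) (fastforce intro: less_imp_le)+

lemma sum_part: "sum x V = sum x (part e v) + beyond e v"
  unfolding beyond_def using sum.subset_diff[of "part e v" V x] partV fin by fastforce

lemma beyond_pos:
  assumes e: "e \<in> E" "v \<in> e"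
  shows "0 < beyond e v"
proof -
  obtain u where u: "u \<in> e" "u \<noteq> v" using edge_other_vertex[OF e(1)] .
  have "u \<in> V - part e v" using part_sub_beyond[OF e u] part_self[OF e(1) u(1)] by blast
  then show ?thesis unfolding beyond_def using fin pos by (intro sum_pos) auto
qed

section \<open>Moves that cannot keep a maximiser branching\<close>

lemma no_move:
  assumes f: "f \<in> E" "v \<in> f" and u: "u \<in> part f v" "u \<noteq> v" and two: "d u v \<le> 2"
    and K: "potential x u - potential x v > real (d u v) * (x v + beyond f v - x u)"
  shows "\<not> branching (move f v u)"
proof
  assume "branching (move f v u)"
  then have "distance_spectral_radius \<lparr>verts = V, edges = move f v u\<rparr> \<le> radius"
    using maximal[OF utree_move[OF f u]] by blast
  moreover have "real (d u v) < radius" using two radius_gt by linarith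
  ultimately show False
    using radius_less_move[OF f u pos eig _ K[unfolded beyond_def]] by fastforce
qed

text \<open>By \<open>potential_diff\<close> the gain in potential is the weight of
  \<open>part e v\<close> minus that of \<open>part e u\<close>. The former contains
  \<open>v\<close> and the disjoint branches through \<open>f\<close> and \<open>g\<close>, so the
  branch through \<open>g\<close> has only to outweigh \<open>part e u\<close> without
  \<open>u\<close>.\<close>

lemma no_move_adjacent:
  assumes E: "e \<in> E" "f \<in> E" "g \<in> E" "e \<noteq> f" "e \<noteq> g" "f \<noteq> g" and v: "v \<in> e" "v \<in> f" "v \<in> g"
    and u: "u \<in> e" "u \<noteq> v" and less: "sum x (part e u) < x u + beyond g v"
  shows "\<not> branching (move f v u)"
proof (rule no_move[OF E(2) v(2) _ u(2)])
  show "u \<in> part f v" using edge_within'[OF E(1,2,4) v(2,1)] u by blast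
  have d: "d u v = 1" using adjacent_dist[OF E(1) u(1) v(1) u(2)] .
  then show "d u v \<le> 2" by simp
  let ?F = "V - part f v" and ?G = "V - part g v"
  have F: "?F \<subseteq> part e v" "?G \<subseteq> part e v" "?F \<inter> ?G = {}" "v \<notin> ?F" "v \<notin> ?G"
    using beyond_disjoint E v part_self by blast+
  have "x v + beyond f v + beyond g v = sum x (insert v (?F \<union> ?G))"
    using F fin by (simp add: sum.union_disjoint beyond_def)
  also have "\<dots> \<le> sum x (part e v)"
    by (rule sum_mono_pos) (use F part_self[OF E(1) v(1)] partV in auto)
  finally show "potential x u - potential x v > real (d u v) * (x v + beyond f v - x u)"
    using potential_diff[OF E(1) u(1) v(1) u(2)] d less by simp
qed

lemma no_move_adjacent_light:
  assumes E: "e \<in> E" "f \<in> E" "g \<in> E" "e \<noteq> f" "e \<noteq> g" "f \<noteq> g" and v: "v \<in> e" "v \<in> f" "v \<in> g"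
    and u: "u \<in> e" "u \<noteq> v" and le: "beyond e v \<le> beyond g v"
  shows "\<not> branching (move f v u)"
proof (rule no_move_adjacent[OF E v u])
  have "sum x (part e u) \<le> beyond e v"
    unfolding beyond_def by (rule sum_mono_pos) (use part_sub_beyond[OF E(1) v(1) u] in auto)
  then show "sum x (part e u) < x u + beyond g v" using le pos[OF edgeV[OF E(1) u(1)]] by linarith
qed

lemma no_move_adjacent_leaf:
  assumes E: "e \<in> E" "f \<in> E" "g \<in> E" "e \<noteq> f" "e \<noteq> g" "f \<noteq> g" and v: "v \<in> e" "v \<in> f" "v \<in> g"
    and u: "u \<in> e" "u \<noteq> v" "\<not> junction E e u"
  shows "\<not> branching (move f v u)"
  using no_move_adjacent[OF E v u(1,2)] part_leaf[OF E(1) u(1,3)] beyond_pos[OF E(3) v(3)] by simp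

text \<open>Here \<open>f\<close> moves over distance 2, from \<open>v\<close> past \<open>w\<close>
  to a leaf \<open>y\<close> of \<open>g\<close>. Adding the two potential differences and bounding
  the total weight by the parts of \<open>v\<close>, \<open>w\<close> and \<open>t\<close> gives at
  least \<open>2 * sum x (part e v) + x t + beyond h t - beyond g w - x y\<close>. As
  \<open>part e v\<close> weighs \<open>x v + beyond f v\<close>, the assumption \<open>le\<close>
  makes this exceed the threshold.\<close>

lemma no_move_across:
  assumes e: "e \<in> E" "v \<in> e" "w \<in> e" "t \<in> e" "v \<noteq> w" "v \<noteq> t" "w \<noteq> t"
    and f: "f \<in> E" "f \<noteq> e" "v \<in> f" "\<And>h. h \<in> E \<Longrightarrow> v \<in> h \<Longrightarrow> h = e \<or> h = f"
    and g: "g \<in> E" "g \<noteq> e" "w \<in> g" "\<And>h. h \<in> E \<Longrightarrow> w \<in> h \<Longrightarrow> h = e \<or> h = g"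
    and h: "h \<in> E" "h \<noteq> e" "t \<in> h"
    and y: "y \<in> g" "y \<noteq> w" "\<not> junction E g y"
    and le: "beyond g w \<le> beyond h t"
  shows "\<not> branching (move f v y)"
proof -
  have gf: "g \<noteq> f" using edge_inter[OF e(1) f(1) f(2)[symmetric] e(2) f(3) e(3)] g(3) e(5) by blast
  have wf: "w \<in> part f v" using edge_within'[OF e(1) f(1) f(2)[symmetric] f(3) e(2)] e(3) by blast
  have yf: "y \<in> part f v" using edge_within[OF g(1) f(1) gf f(3) g(3) wf y(1)] .
  have yv: "y \<noteq> v" using edge_inter[OF e(1) g(1) g(2)[symmetric] e(3) g(3) e(2)] y(1) e(5) by blast
  have yw: "y \<in> part e w" using edge_within'[OF g(1) e(1) g(2) e(3) g(3)] y(1) by blast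
  have "d y v = d y w + 1" using partD[OF yw e(2,5)] .
  then have d: "d y v = 2" using adjacent_dist[OF g(1) y(1) g(3) y(2)] by simp
  have pv: "sum x (part e v) = x v + beyond f v"
    using part_two_edges[OF e(1) f(1) f(2)[symmetric] e(2) f(3) f(4)] part_self[OF f(1,3)] fin
    by (simp add: beyond_def)
  have pw: "sum x (part e w) = x w + beyond g w"
    using part_two_edges[OF e(1) g(1) g(2)[symmetric] e(3) g(3) g(4)] part_self[OF g(1,3)] fin
    by (simp add: beyond_def)
  have "insert t (V - part h t) \<subseteq> part e t"
    using beyond_disjoint[OF h(1) e(1) h(2,3) e(4)] part_self[OF e(1,4)] by blast
  then have "sum x (insert t (V - part h t)) \<le> sum x (part e t)"
    by (rule sum_mono_pos) (use partV in blast)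
  then have pt: "x t + beyond h t \<le> sum x (part e t)"
    using part_self[OF h(1,3)] fin by (simp add: beyond_def)
  have fp: "finite (part e a)" for a using fin partV finite_subset by (metis subsetI)
  have dis: "part e a \<inter> part e b = {}" if "a \<in> e" "b \<in> e" "a \<noteq> b" for a b
    using part_unique that by blast
  have "sum x (part e v) + sum x (part e w) + sum x (part e t) = sum x (part e v \<union> part e w \<union> part e t)"
  proof -
    have "(part e v \<union> part e w) \<inter> part e t = {}" using dis[OF e(2,4,6)] dis[OF e(3,4,7)] by blast
    then show ?thesis using dis[OF e(2,3,5)] fp by (simp add: sum.union_disjoint)
  qed
  also have "\<dots> \<le> sum x V" by (rule sum_mono_pos) (use partV in blast)+
  finally have S: "sum x (part e v) + sum x (part e w) + sum x (part e t) \<le> sum x V" .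
  have "potential x y - potential x w = sum x (part g w) - x y"
    using potential_diff[OF g(1) y(1) g(3) y(2)] part_leaf[OF g(1) y(1,3)] by simp
  moreover have "potential x w - potential x v = sum x (part e v) - sum x (part e w)"
    using potential_diff[OF e(1,3,2)] e(5) by blast
  ultimately have "potential x y - potential x v > real (d y v) * (x v + beyond f v - x y)"
    using S pv pw pt le sum_part[of g w] pos[OF edgeV[OF g(1) y(1)]] pos[OF edgeV[OF e(1,4)]] d
    by simp
  then show ?thesis using no_move[OF f(1,3) yf yv] d by simp
qed

text \<open>A further junction \<open>u\<close> would make \<open>g\<close> a branching edge after
  the move: \<open>w\<close> still meets \<open>e\<close>, \<open>u\<close> still meets its other
  edge, and \<open>y\<close> meets the moved one.\<close>

lemma pendant_if_no_move:
  assumes e: "e \<in> E" "v \<in> e" "w \<in> e" "v \<noteq> w"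
    and f: "f \<in> E" "f \<noteq> e" "v \<in> f" and g: "g \<in> E" "g \<noteq> e" "w \<in> g"
    and y: "y \<in> g" "y \<noteq> w" "\<not> junction E g y"
    and nb: "\<not> branching (move f v y)" and u: "junction E g u"
  shows "u = w"
proof (rule ccontr)
  assume uw: "u \<noteq> w"
  obtain h where h: "u \<in> g" "h \<in> E" "h \<noteq> g" "u \<in> h" using junctionE[OF u] .
  have gw: "g \<subseteq> part e w" using edge_within'[OF g(1) e(1) g(2) e(3) g(3)] .
  have fv: "f \<subseteq> part e v" using edge_within'[OF f(1) e(1) f(2) e(2) f(3)] .
  have dis: "a \<notin> f" if "a \<in> g" for a using part_unique[OF _ _ e(2,3)] e(4) gw fv that by blast
  have gf: "g \<noteq> f" "h \<noteq> f" using dis h g by blast+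
  have ye: "y \<noteq> u" using y u by blast
  have wf: "w \<in> part f v" using edge_within'[OF e(1) f(1) f(2)[symmetric] f(3) e(2)] e(3) by blast
  have yf: "y \<in> part f v" using edge_within[OF g(1) f(1) gf(1) f(3) g(3) wf y(1)] .
  have yv: "y \<noteq> v" using dis[OF y(1)] f(3) by blast
  have new: "insert y (f - {v}) \<notin> E" using moved_edge_new[OF f(1,3) yf yv] by blast
  have "branching (move f v y)"
  proof (rule branching_edgeI[OF move_keep[OF g(1) gf(1)] uw[symmetric] y(2)[symmetric] ye[symmetric]])
    show "junction (move f v y) g w"
      by (rule junctionI[OF g(3) move_keep[OF e(1) f(2)[symmetric]] g(2)[symmetric] e(3)])
    show "junction (move f v y) g u"
      by (rule junctionI[OF h(1) move_keep[OF h(2) gf(2)] h(3,4)])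
    show "junction (move f v y) g y"
      by (rule junctionI[OF y(1) move_new]) (use new g in auto)
  qed
  then show False using nb by blast
qed

text \<open>For ordinary trees two pendant edges at \<open>v\<close> remain, and deleting one leaves
  a path. For \<open>k >= 3\<close> all three edges at the vertex turn out to be pendant, which is
  too few edges.\<close>

lemma branching_vertex_structure:
  assumes "branching_vertex E v0"
  obtains v e1 e2 where "k = 2" "e1 \<in> E" "e2 \<in> E" "e1 \<noteq> e2" "v \<in> e1" "v \<in> e2"
    "\<forall>u. junction E e1 u \<longrightarrow> u = v" "\<forall>u. junction E e2 u \<longrightarrow> u = v" "\<not> branching (E - {e1})"
proof -
  obtain a b c where abc: "a \<in> E" "b \<in> E" "c \<in> E" "a \<noteq> b" "a \<noteq> c" "b \<noteq> c" "v0 \<in> a" "v0 \<in> b" "v0 \<in> c"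
    using assms unfolding branching_vertex_def by blast
  let ?S = "{e \<in> E. v0 \<in> e}"
  have S: "finite ?S" "?S \<noteq> {}" using finE abc by auto
  \<comment> \<open>The lightest branch at \<open>v0\<close>. With \<open>e2\<close> then taken as
    the lighter of two others, \<open>e2\<close> may be moved along \<open>e1\<close> and
    \<open>e1\<close> along \<open>e2\<close>, both weighed against \<open>e3\<close>.\<close>
  define e1 where "e1 = arg_min_on (\<lambda>e. beyond e v0) ?S"
  have e1: "e1 \<in> E" "v0 \<in> e1" using arg_min_if_finite(1)[OF S, of "\<lambda>e. beyond e v0"] by (auto simp: e1_def)
  have min: "beyond e1 v0 \<le> beyond e v0" if "e \<in> E" "v0 \<in> e" for e
    using arg_min_least[OF S, of e "\<lambda>e. beyond e v0"] that by (simp add: e1_def)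
  have "\<exists>f g. f \<in> E \<and> g \<in> E \<and> f \<noteq> e1 \<and> g \<noteq> e1 \<and> f \<noteq> g \<and> v0 \<in> f \<and> v0 \<in> g"
    using abc by metis
  then obtain f g where "f \<in> E" "g \<in> E" "f \<noteq> e1" "g \<noteq> e1" "f \<noteq> g" "v0 \<in> f" "v0 \<in> g"
    by blast
  then obtain e2 e3 where E: "e2 \<in> E" "e3 \<in> E" "e2 \<noteq> e1" "e3 \<noteq> e1" "e2 \<noteq> e3" "v0 \<in> e2" "v0 \<in> e3"
    "beyond e2 v0 \<le> beyond e3 v0"
    by (metis linear)
  have p1: "u = v0" if "junction E e1 u" for u
  proof (rule ccontr)
    assume u: "u \<noteq> v0"
    have "\<not> branching (move e2 v0 u)"
      using no_move_adjacent_light[OF e1(1) E(1,2) E(3)[symmetric] E(4)[symmetric] E(5) e1(2) E(6,7) _ u]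
        min[OF E(2,7)] that by (simp add: junction_def)
    then show False using branching_move_junction[OF e1(1) E(1) E(3)[symmetric] e1(2) E(6) that u] by blast
  qed
  \<comment> \<open>With a fourth edge, \<open>v0\<close> would remain a branching vertex when
    \<open>e2\<close> is moved away.\<close>
  have only: "h = e1 \<or> h = e2 \<or> h = e3" if h: "h \<in> E" "v0 \<in> h" for h
  proof (rule ccontr)
    assume n: "\<not> ?thesis"
    obtain u where u: "u \<in> e1" "u \<noteq> v0" using edge_other_vertex[OF e1(1)] .
    have "\<not> branching (move e2 v0 u)"
      using no_move_adjacent_light[OF e1(1) E(1,2) E(3)[symmetric] E(4)[symmetric] E(5) e1(2) E(6,7) u]
        min[OF E(2,7)] by simp
    moreover have "branching (move e2 v0 u)"
      by (rule branching_vertexI[OF move_keep[OF e1(1)] move_keep[OF E(2)] move_keep[OF h(1)]])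
        (use n E e1 h in blast)+
    ultimately show False by blast
  qed
  have m1: "\<not> branching (move e1 v0 u)" if "u \<in> e2" "u \<noteq> v0" for u
    using no_move_adjacent_light[OF E(1) e1(1) E(2,3,5) E(4)[symmetric] E(6) e1(2) E(7) that E(8)] .
  have p2: "u = v0" if "junction E e2 u" for u
    using m1[of u] branching_move_junction[OF E(1) e1(1) E(3) E(6) e1(2) that] that
    by (auto simp: junction_def)
  obtain u where "u \<in> e2" "u \<noteq> v0" using edge_other_vertex[OF E(1)] .
  then have nb: "\<not> branching (E - {e1})" using m1 branching_mono Diff_subset_move by metis
  have "\<not> 3 \<le> k"
  proof
    assume k: "3 \<le> k"
    have not1: "q \<notin> e1" if "q \<in> e3" "q \<noteq> v0" for q
      using edge_inter[OF E(2) e1(1) E(4) E(7) e1(2) that(1)] that(2) by blast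
    \<comment> \<open>The junctions of \<open>e3\<close> survive the deletion of \<open>e1\<close>:
      \<open>v0\<close> still meets \<open>e2\<close>, and the others do not lie on
      \<open>e1\<close>. So a branching \<open>e3\<close> would contradict
      \<open>nb\<close>.\<close>
    have "\<not> branching_edge E e3"
    proof
      assume "branching_edge E e3"
      then obtain q1 q2 q3 where q: "junction E e3 q1" "junction E e3 q2" "junction E e3 q3"
        "q1 \<noteq> q2" "q1 \<noteq> q3" "q2 \<noteq> q3"
        unfolding branching_edge_def by blast
      have "junction (E - {e1}) e3 p" if p: "junction E e3 p" for p
      proof (cases "p = v0")
        case True
        then show ?thesis using E junctionI[of v0 e3 e2 "E - {e1}"] by blast
      next
        case False
        obtain h where h: "p \<in> e3" "h \<in> E" "h \<noteq> e3" "p \<in> h" using junctionE[OF p] .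
        then have "h \<noteq> e1" using not1[OF h(1) False] by blast
        then show ?thesis using h by (auto intro: junctionI)
      qed
      then have "branching (E - {e1})"
        using branching_edgeI[of e3 "E - {e1}" q1 q2 q3] q E by blast
      then show False using nb by blast
    qed
    moreover have "junction E e3 v0" using E(6,7) E(1,5) by (auto intro: junctionI)
    ultimately obtain p where p: "p \<in> e3" "p \<noteq> v0" "\<not> junction E e3 p"
      using branching_edge_exists_leaf[OF E(2) _ k] by metis
    have "\<not> branching (move e1 v0 p)"
      using no_move_adjacent_leaf[OF E(2) e1(1) E(1) E(4) E(5)[symmetric] E(3)[symmetric] E(7) e1(2) E(6) p] .
    have "u = v0" if u: "junction E e3 u" for u
    proof (rule ccontr)
      assume uv: "u \<noteq> v0"
      obtain h where h: "u \<in> e3" "h \<in> E" "h \<noteq> e3" "u \<in> h" using junctionE[OF u] .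
      have he: "h \<noteq> e1" using not1[OF h(1) uv] h(4) by blast
      have pf: "p \<in> part e1 v0" using edge_within'[OF E(2) e1(1) E(4) e1(2) E(7)] p(1) by blast
      have new: "insert p (e1 - {v0}) \<notin> E" using moved_edge_new[OF e1 pf p(2)] by blast
      have "branching (move e1 v0 p)"
      proof (rule branching_edgeI[OF move_keep[OF E(2,4)] p(2) _ uv[symmetric]])
        show "p \<noteq> u" using p u by blast
        show "junction (move e1 v0 p) e3 p"
          by (rule junctionI[OF p(1) move_new]) (use new E in auto)
        show "junction (move e1 v0 p) e3 v0"
          by (rule junctionI[OF E(7) move_keep[OF E(1,3)] E(5,6)])
        show "junction (move e1 v0 p) e3 u"
          by (rule junctionI[OF h(1) move_keep[OF h(2) he] h(3,4)])
      qed
      then show False using \<open>\<not> branching (move e1 v0 p)\<close> by blast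
    qed
    note p3 = this
    \<comment> \<open>A vertex of a further edge would lie in the part of a vertex other than
      \<open>v0\<close> of one of the three edges, but these vertices are leaves.\<close>
    have "h \<in> {e1, e2, e3}" if h: "h \<in> E" for h
    proof (rule ccontr)
      assume n: "h \<notin> {e1, e2, e3}"
      then have vh: "v0 \<notin> h" using only[OF h] by blast
      obtain a where a: "a \<in> h" using edge_ne[OF h] by blast
      have aV: "a \<in> V" "a \<noteq> v0" using edgeV[OF h a] a vh by blast+
      obtain e' w where e': "e' \<in> E" "v0 \<in> e'" "w \<in> e'" "d a v0 = d a w + 1"
        using descent[OF aV(1) edgeV[OF e1] aV(2)] .
      have "a \<notin> part e' v0" using part_no_parent[OF _ e'(3,4)] by blast
      then obtain q where q: "q \<in> e'" "q \<noteq> v0" "a \<in> part e' q"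
        using not_partD[OF aV(1) e'(1,2)] by metis
      have e'3: "e' = e1 \<or> e' = e2 \<or> e' = e3" using only[OF e'(1,2)] .
      then have "\<not> junction E e' q" using p1 p2 p3 q(2) by blast
      then have "a = q" using part_leaf[OF e'(1) q(1)] q(3) by blast
      moreover have "h \<noteq> e'" using n e'3 by blast
      ultimately have "junction E e' q" using q(1) h a by (auto intro: junctionI)
      then show False using \<open>\<not> junction E e' q\<close> by blast
    qed
    then have "card E \<le> card {e1, e2, e3}" by (intro card_mono) auto
    also have "\<dots> \<le> 3" by (simp add: card_insert_if)
    finally show False using four by simp
  qed
  then have "k = 2" using k2 by simp
  then show thesis using that[of e1 e2 v0] e1 E p1 p2 nb by blast
qed

text \<open>The triple \<open>(e, v1, e1)\<close> is chosen with the lightest branch beyond \<open>v1\<close>, so that \<open>e1\<close>, whose own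
  branches are lighter still, cannot be a branching edge.\<close>

lemma branching_edge_structure:
  assumes nov: "\<And>v. \<not> branching_vertex E v" and "e0 \<in> E" "branching_edge E e0"
  obtains e v1 v2 e1 e2 where "3 \<le> k" "e \<in> E" "e1 \<in> E" "e2 \<in> E" "e1 \<noteq> e" "e2 \<noteq> e" "e1 \<noteq> e2"
    "v1 \<in> e" "v1 \<in> e1" "v2 \<in> e" "v2 \<in> e2" "v1 \<noteq> v2"
    "\<forall>u. junction E e1 u \<longrightarrow> u = v1" "\<forall>u. junction E e2 u \<longrightarrow> u = v2"
    "\<forall>f\<in>E. v1 \<in> f \<longrightarrow> f = e \<or> f = e1" "\<not> branching (E - {e1})"
proof -
  have only: "h = e \<or> h = f" if "e \<in> E" "f \<in> E" "e \<noteq> f" "v \<in> e" "v \<in> f" "h \<in> E" "v \<in> h" for e f h v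
    using nov[of v] that unfolding branching_vertex_def by blast
  have k: "3 \<le> k"
  proof -
    obtain u v w where "u \<noteq> v" "u \<noteq> w" "v \<noteq> w" "{u, v, w} \<subseteq> e0"
      using assms(3) unfolding branching_edge_def junction_def by blast
    then have "card {u, v, w} = 3" "card {u, v, w} \<le> card e0"
      using card_mono[OF fin_edge[OF assms(2)], of "{u, v, w}"] by simp_all
    then show ?thesis using edge_card[OF assms(2)] by simp
  qed
  let ?C = "{(e, v, f). e \<in> E \<and> f \<in> E \<and> f \<noteq> e \<and> v \<in> e \<and> v \<in> f \<and> branching_edge E e}"
  have "?C \<subseteq> E \<times> V \<times> E" using edgeV by auto
  then have C: "finite ?C" using finE fin by (meson finite_SigmaI finite_subset)
  obtain q where "junction E e0 q" using assms(3) unfolding branching_edge_def by blast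
  then obtain h where "q \<in> e0" "h \<in> E" "h \<noteq> e0" "q \<in> h" by (rule junctionE)
  then have "(e0, q, h) \<in> ?C" using assms(2,3) by simp
  then have Cne: "?C \<noteq> {}" by blast
  obtain e v1 e1 where e: "e \<in> E" "e1 \<in> E" "e1 \<noteq> e" "v1 \<in> e" "v1 \<in> e1" "branching_edge E e"
    and min: "\<And>e' v f. e' \<in> E \<Longrightarrow> f \<in> E \<Longrightarrow> f \<noteq> e' \<Longrightarrow> v \<in> e' \<Longrightarrow> v \<in> f \<Longrightarrow> branching_edge E e' \<Longrightarrow>
      beyond e1 v1 \<le> beyond f v"
  proof -
    let ?b = "\<lambda>(e, v, f). beyond f v"
    obtain e v f where m: "arg_min_on ?b ?C = (e, v, f)" by (cases "arg_min_on ?b ?C")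
    have "(e, v, f) \<in> ?C" using arg_min_if_finite(1)[OF C Cne, of ?b] m by simp
    moreover have "beyond f v \<le> beyond f' v'" if "(e', v', f') \<in> ?C" for e' v' f'
      using arg_min_least[OF C Cne that, of ?b] m by simp
    ultimately show thesis using that[of e f v] by blast
  qed
  have j1: "junction E e1 v1" using junctionI[OF e(5,1) e(3)[symmetric] e(4)] .
  have "\<not> branching_edge E e1"
  proof
    assume br: "branching_edge E e1"
    then obtain u where u: "junction E e1 u" "u \<noteq> v1" unfolding branching_edge_def by metis
    obtain h where h: "u \<in> e1" "h \<in> E" "h \<noteq> e1" "u \<in> h" using junctionE[OF u(1)] .
    have "beyond e1 v1 \<le> beyond h u" using min[OF e(2) h(2,3,1,4) br] .
    moreover have "insert u (V - part h u) \<subseteq> V - part e1 v1"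
      using beyond_disjoint[OF h(2) e(2) h(3,4,1)] part_self[OF e(2) h(1)]
        part_sub_beyond[OF e(2,5) h(1) u(2)] by blast
    then have "sum x (insert u (V - part h u)) \<le> beyond e1 v1"
      unfolding beyond_def by (rule sum_mono_pos) blast
    then have "x u + beyond h u \<le> beyond e1 v1"
      using part_self[OF h(2,4)] fin by (simp add: beyond_def)
    ultimately show False using pos[OF edgeV[OF e(2) h(1)]] by linarith
  qed
  then obtain y where y: "y \<in> e1" "y \<noteq> v1" "\<not> junction E e1 y"
    using branching_edge_exists_leaf[OF e(2) j1 k] by metis
  have "\<exists>v2 v3. junction E e v2 \<and> junction E e v3 \<and> v2 \<noteq> v1 \<and> v3 \<noteq> v1 \<and> v2 \<noteq> v3"
    using e(6) unfolding branching_edge_def by metis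
  then obtain v2' v3' e2' e3' where "v2' \<in> e" "v3' \<in> e" "v2' \<noteq> v1" "v3' \<noteq> v1" "v2' \<noteq> v3'"
    "e2' \<in> E" "e2' \<noteq> e" "v2' \<in> e2'" "e3' \<in> E" "e3' \<noteq> e" "v3' \<in> e3'"
    unfolding junction_def by blast
  then obtain v2 v3 e2 e3 where v: "v2 \<in> e" "v3 \<in> e" "v2 \<noteq> v1" "v3 \<noteq> v1" "v2 \<noteq> v3"
    and e2: "e2 \<in> E" "e2 \<noteq> e" "v2 \<in> e2" and e3: "e3 \<in> E" "e3 \<noteq> e" "v3 \<in> e3"
    and le: "beyond e2 v2 \<le> beyond e3 v3"
    by (metis linear)
  have o1: "h = e \<or> h = e1" if "h \<in> E" "v1 \<in> h" for h
    using only[OF e(1,2) e(3)[symmetric] e(4,5) that] .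
  have o2: "h = e \<or> h = e2" if "h \<in> E" "v2 \<in> h" for h
    using only[OF e(1) e2(1) e2(2)[symmetric] v(1) e2(3) that] .
  have o3: "h = e \<or> h = e3" if "h \<in> E" "v3 \<in> h" for h
    using only[OF e(1) e3(1) e3(2)[symmetric] v(2) e3(3) that] .
  \<comment> \<open>The minimal branch beyond \<open>v1\<close> is no heavier than those at
    \<open>v2\<close> and \<open>v3\<close>, so either of \<open>e2\<close> and \<open>e3\<close>
    may be moved to the leaf \<open>y\<close> of \<open>e1\<close>, with the other as the
    counterweight.\<close>
  have nb2: "\<not> branching (move e2 v2 y)"
    using no_move_across[OF e(1) v(1) e(4) v(2) v(3) v(5) v(4)[symmetric] e2 o2 e(2,3,5) o1 e3 y]
      min[OF e(1) e3(1,2) v(2) e3(3) e(6)] by blast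
  have nb3: "\<not> branching (move e3 v3 y)"
    using no_move_across[OF e(1) v(2) e(4) v(1) v(4) v(5)[symmetric] v(3)[symmetric] e3 o3 e(2,3,5) o1 e2 y]
      min[OF e(1) e2(1,2) v(1) e2(3) e(6)] by blast
  have p1: "u = v1" if "junction E e1 u" for u
    using pendant_if_no_move[OF e(1) v(1) e(4) v(3) e2 e(2,3,5) y nb2 that] .
  have dis: "a \<notin> e3" if "a \<in> e2" for a
    using edge_within'[OF e2(1) e(1) e2(2) v(1) e2(3)] edge_within'[OF e3(1) e(1) e3(2) v(2) e3(3)]
      part_unique[OF _ _ v(1,2)] v(5) that by blast
  \<comment> \<open>Since \<open>e2\<close> and \<open>e3\<close> are disjoint, a branching
    \<open>e2\<close> would survive the move of \<open>e3\<close>, contradicting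
    \<open>nb3\<close>.\<close>
  have "\<not> branching_edge E e2"
  proof
    assume "branching_edge E e2"
    then obtain q1 q2 q3 where q: "junction E e2 q1" "junction E e2 q2" "junction E e2 q3"
      "q1 \<noteq> q2" "q1 \<noteq> q3" "q2 \<noteq> q3"
      unfolding branching_edge_def by blast
    have "junction (E - {e3}) e2 p" if "junction E e2 p" for p
      using that dis unfolding junction_def by blast
    moreover have "e2 \<in> E - {e3}" using dis e2 by blast
    ultimately have "branching (E - {e3})" using branching_edgeI[of e2 "E - {e3}" q1 q2 q3] q by blast
    then show False using nb3 branching_mono Diff_subset_move by metis
  qed
  moreover have "junction E e2 v2" using junctionI[OF e2(3) e(1) e2(2)[symmetric] v(1)] .
  ultimately obtain y2 where y2: "y2 \<in> e2" "y2 \<noteq> v2" "\<not> junction E e2 y2"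
    using branching_edge_exists_leaf[OF e2(1) _ k] by metis
  \<comment> \<open>Now the roles of \<open>e1\<close> and \<open>e2\<close> are exchanged, and the
    comparison needed is that of \<open>e2\<close> with \<open>e3\<close>.\<close>
  have nb1: "\<not> branching (move e1 v1 y2)"
    using no_move_across[OF e(1,4) v(1,2) v(3)[symmetric] v(4)[symmetric] v(5) e(2,3,5) o1 e2 o2 e3 y2 le]
    by blast
  have p2: "u = v2" if "junction E e2 u" for u
    using pendant_if_no_move[OF e(1,4) v(1) v(3)[symmetric] e(2,3,5) e2 y2 nb1 that] .
  have "\<not> branching (E - {e1})" using nb1 branching_mono Diff_subset_move by metis
  moreover have "e1 \<noteq> e2"
    using edge_inter[OF e(1,2) e(3)[symmetric] e(4,5) v(1)] e2(3) v(3) by blast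
  ultimately show thesis
    using that[OF k e(1,2) e2(1) e(3) e2(2) _ e(4,5) v(1) e2(3) v(3)[symmetric]] p1 p2 o1 by simp
qed

end

section \<open>Loose paths\<close>

lemma finite_obtains_max:
  fixes f :: "'a \<Rightarrow> 'b :: linorder"
  assumes "finite S" "S \<noteq> {}"
  obtains x where "x \<in> S" "\<And>y. y \<in> S \<Longrightarrow> f y \<le> f x"
proof -
  have "Max (f ` S) \<in> f ` S" using assms by (intro Max_in) auto
  then obtain x where "x \<in> S" "f x = Max (f ` S)" by auto
  then show thesis using that[of x] assms(1) by simp
qed

lemma bij_betw_pointed:
  assumes "finite A" "finite B" "card A = card B" "z \<in> A" "w \<in> B"
  obtains h where "bij_betw h A B" "h z = w"
proof -
  obtain h where h: "bij_betw h A B" using finite_same_card_bij[OF assms(1-3)] by blast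
  have "h z \<in> B" using bij_betwE[OF h] assms(4) by blast
  then have "bij_betw (transpose (h z) w) B B" using assms(5) by simp
  then have "bij_betw (transpose (h z) w \<circ> h) A B" using h by (rule bij_betw_trans[rotated])
  then show thesis by (rule that) simp
qed

lemma loose_edge_Suc: "2 \<le> k \<Longrightarrow> loose_edge k (Suc i) = {1 + (k - 1) * i .. 1 + (k - 1) * Suc i}"
  by (cases k) (auto simp: loose_edge_def algebra_simps)

lemma loose_path_edges:
  assumes "2 \<le> k"
  shows "edges (loose_path (1 + (k - 1) * m) k) = loose_edge k ` {1..m}"
    and "verts (loose_path (1 + (k - 1) * m) k) = {1..1 + (k - 1) * m}"
  using assms by (simp_all add: loose_path_def)

context utree
begin

lemma utree_remove_pendant:
  assumes f: "f \<in> E" "v \<in> f" and pend: "\<And>u. junction E f u \<Longrightarrow> u = v"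
  shows "utree (V - (f - {v})) (E - {f}) k d"
proof
  let ?V = "V - (f - {v})"
  have sub: "e \<subseteq> ?V" if "e \<in> E - {f}" for e
    using that edge_sub pend junctionI[of _ f e E] by blast
  show "finite ?V" using fin by simp
  show "2 \<le> k" by (rule k2)
  show "e \<subseteq> ?V" if "e \<in> E - {f}" for e using sub[OF that] .
  show "card e = k" if "e \<in> E - {f}" for e using edge_card that by blast
  have "f - {v} \<subseteq> V" "card (f - {v}) = k - 1"
    using edge_sub[OF f(1)] edge_card[OF f(1)] f(2) by auto
  then have "card ?V = card V - (k - 1)"
    using card_Diff_subset[of "f - {v}" V] fin_edge[OF f(1)] by simp
  moreover obtain m where m: "card E = Suc m"
    using f(1) finE by (metis card_Suc_Diff1)
  moreover have "card (E - {f}) = m" using m f(1) finE by simp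
  ultimately show "card ?V = 1 + (k - 1) * card (E - {f})" using count by simp
  show "dist_from ?V (E - {f}) a (d a)" if a: "a \<in> ?V" for a
  proof -
    have aV: "a \<in> V" using a by blast
    have af: "a \<in> part f v"
    proof (rule ccontr)
      assume "a \<notin> part f v"
      then obtain g where g: "g \<in> f" "g \<noteq> v" "a \<in> part f g" using not_partD[OF aV f] by metis
      then have "a = g" using part_leaf[OF f(1) g(1)] pend by blast
      then show False using g a by blast
    qed
    have "\<exists>e\<in>E - {f}. b \<in> e \<and> (\<exists>w\<in>e \<inter> ?V. d a b = d a w + 1)" if b: "b \<in> ?V" "b \<noteq> a" for b
    proof -
      obtain e w where e: "e \<in> E" "b \<in> e" "w \<in> e" "d a b = d a w + 1"
        using descent[OF aV _ b(2)[symmetric]] b(1) by blast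
      have "e \<noteq> f"
      proof
        assume ef: "e = f"
        then have "b = v" using b(1) e(2) by blast
        then show False using part_no_parent[OF af e(3)] e(4) ef by blast
      qed
      then show ?thesis using e sub[of e] by blast
    qed
    note desc = this
    have old: "\<forall>b\<in>V. d a b = 0 \<longleftrightarrow> b = a"
      "\<forall>e\<in>E. \<forall>w\<in>e \<inter> V. \<forall>w'\<in>e \<inter> V. d a w' \<le> d a w + 1"
      using dist[OF aV] unfolding dist_from_def by simp_all
    show ?thesis
      unfolding dist_from_def
    proof (intro conjI)
      show "\<forall>b\<in>?V. d a b = 0 \<longleftrightarrow> b = a" by (intro ballI) (simp add: old(1))
      show "\<forall>e\<in>E - {f}. \<forall>w\<in>e \<inter> ?V. \<forall>w'\<in>e \<inter> ?V. d a w' \<le> d a w + 1" using old(2) by blast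
      show "\<forall>b\<in>?V. b \<noteq> a \<longrightarrow> (\<exists>e\<in>E - {f}. b \<in> e \<and> (\<exists>w\<in>e \<inter> ?V. d a b = d a w + 1))"
        using desc by (intro ballI impI)
    qed
  qed
qed

lemma only_edge:
  assumes "f \<in> E" "\<And>u. \<not> junction E f u"
  shows "E = {f}" "V = f"
proof -
  have "a \<in> f" if a: "a \<in> V" for a
  proof -
    obtain g where g: "g \<in> f" "a \<in> part f g" using part_exists[OF a assms(1)] .
    then show ?thesis using part_leaf[OF assms(1) g(1) assms(2)] by simp
  qed
  then show V: "V = f" using edge_sub[OF assms(1)] by blast
  have "e = f" if "e \<in> E" for e
    using V edge_sub[OF that] edge_card[OF that] edge_card[OF assms(1)] fin card_subset_eq by metis
  then show "E = {f}" using assms(1) by blast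
qed

end

text \<open>Induction by removing a pendant edge. The image of \<open>f\<close> and of a chosen
  \<open>z\<close> in \<open>f\<close> is prescribed so that the removed edge can be put back at the
  end of the path; \<open>z\<close> becomes the vertex where the next edge is glued on.\<close>

lemma nonbranching_pendant_iso:
  assumes "utree V E k d" "\<not> branching E" "f \<in> E" "z \<in> f" "j \<in> f" "j \<noteq> z"
    "\<And>u. junction E f u \<Longrightarrow> u = j" "card E = m"
  shows "\<exists>\<phi>. bij_betw \<phi> V {1..1 + (k - 1) * m} \<and> (\<lambda>e. \<phi> ` e) ` E = loose_edge k ` {1..m} \<and>
    \<phi> ` f = loose_edge k m \<and> \<phi> z = 1 + (k - 1) * m"
  using assms
proof (induction m arbitrary: V E f z j)
  case 0
  then interpret utree V E k d by blast
  show ?case using 0 finE by simp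
next
  case (Suc m)
  then interpret utree V E k d by blast
  note f = \<open>f \<in> E\<close> and z = \<open>z \<in> f\<close> and j = \<open>j \<in> f\<close> \<open>j \<noteq> z\<close>
  note pend = \<open>\<And>u. junction E f u \<Longrightarrow> u = j\<close>
  show ?case
  proof (cases "junction E f j")
    case False
    then have nj: "\<not> junction E f u" for u using pend by blast
    have EV: "E = {f}" "V = f" using only_edge[OF f nj] .
    then have m: "m = 0" using Suc.prems by simp
    have "card V = card {1..k}" "finite V" using EV edge_card[OF f] fin by auto
    then obtain h where h: "bij_betw h V {1..k}" "h z = k"
      using bij_betw_pointed[of V "{1..k}" z k] z EV k2 by auto
    have "loose_edge k (Suc 0) = {1..k}" by (simp add: loose_edge_def)
    moreover have "Suc (k - Suc 0) = k" using k2 by simp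
    ultimately show ?thesis using h EV m by (intro exI[of _ h]) (auto simp: bij_betw_def)
  next
    case True
    then obtain f2 where f2: "f2 \<in> E" "f2 \<noteq> f" "j \<in> f2" by (auto elim: junctionE)
    let ?V = "V - (f - {j})" and ?E = "E - {f}"
    interpret R: utree ?V ?E k d by (rule utree_remove_pendant[OF f j(1) pend])
    have jf2: "junction E f2 j" using junctionI[OF f2(3) f f2(2)[symmetric] j(1)] .
    \<comment> \<open>The vertex at which the rest of the path continues from \<open>f2\<close>. If
      \<open>f2\<close> is the other end, any vertex of it besides \<open>j\<close> will do.\<close>
    have "\<exists>j2\<in>f2. j2 \<noteq> j \<and> (\<forall>u. junction E f2 u \<longrightarrow> u = j \<or> u = j2)"
    proof (cases "\<exists>j2. j2 \<noteq> j \<and> junction E f2 j2")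
      case True
      then obtain j2 where j2: "j2 \<noteq> j" "junction E f2 j2" by blast
      have "u = j \<or> u = j2" if "junction E f2 u" for u
        using branching_edgeI[OF f2(1) _ _ _ jf2 j2(2) that] j2(1) \<open>\<not> branching E\<close> by metis
      then show ?thesis using j2 by (auto simp: junction_def)
    next
      case False
      obtain j2 where "j2 \<in> f2" "j2 \<noteq> j" using edge_other_vertex[OF f2(1)] .
      then show ?thesis using False by blast
    qed
    then obtain j2 where j2: "j2 \<in> f2" "j2 \<noteq> j" "\<And>u. junction E f2 u \<Longrightarrow> u = j \<or> u = j2"
      by blast
    have nj: "\<not> junction ?E f2 j"
    proof
      assume "junction ?E f2 j"
      then obtain g where g: "g \<in> E" "g \<noteq> f" "g \<noteq> f2" "j \<in> g" by (auto elim: junctionE)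
      show False
        using branching_vertexI[OF f f2(1) g(1) f2(2)[symmetric] g(2,3)[symmetric] j(1) f2(3) g(4)]
          \<open>\<not> branching E\<close> by blast
    qed
    have p2: "u = j2" if "junction ?E f2 u" for u
      using j2(3)[of u] junction_mono[OF that] nj that by blast
    have nbR: "\<not> branching ?E" using \<open>\<not> branching E\<close> branching_mono[of ?E E] by blast
    have cR: "card ?E = m" using Suc.prems f finE by simp
    obtain \<phi> where \<phi>: "bij_betw \<phi> ?V {1..1 + (k - 1) * m}" "(\<lambda>e. \<phi> ` e) ` ?E = loose_edge k ` {1..m}"
      "\<phi> ` f2 = loose_edge k m" "\<phi> j = 1 + (k - 1) * m"
      using Suc.IH[OF R.utree_axioms nbR _ f2(3) j2(1,2) p2 cR] f2 by blast
    define N where "N = 1 + (k - 1) * m"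
    have cf: "card (f - {j}) = k - 1" using edge_card[OF f] j(1) fin_edge[OF f] by simp
    have "finite (f - {j})" "card (f - {j}) = card {N + 1..N + (k - 1)}" "z \<in> f - {j}"
      "N + (k - 1) \<in> {N + 1..N + (k - 1)}"
      using cf fin_edge[OF f] z j k2 by auto
    then obtain h where h: "bij_betw h (f - {j}) {N + 1..N + (k - 1)}" "h z = N + (k - 1)"
      by (metis bij_betw_pointed finite_atLeastAtMost)
    define \<psi> where "\<psi> a = (if a \<in> f - {j} then h a else \<phi> a)" for a
    have b1: "bij_betw \<psi> (f - {j}) {N + 1..N + (k - 1)}"
      using h(1) by (rule bij_betw_cong[THEN iffD1, rotated]) (simp add: \<psi>_def)
    have b2: "bij_betw \<psi> ?V {1..N}"
      using \<phi>(1) unfolding N_def by (rule bij_betw_cong[THEN iffD1, rotated]) (auto simp: \<psi>_def)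
    have "bij_betw \<psi> (?V \<union> (f - {j})) ({1..N} \<union> {N + 1..N + (k - 1)})"
      by (rule bij_betw_combine[OF b2 b1]) auto
    moreover have "?V \<union> (f - {j}) = V" using edge_sub[OF f] by blast
    moreover have N': "N + (k - 1) = 1 + (k - 1) * Suc m" by (simp add: N_def)
    moreover have "{1..N} \<union> {N + 1..N + (k - 1)} = {1..1 + (k - 1) * Suc m}"
      unfolding N'[symmetric] by (auto simp: N_def)
    ultimately have bij: "bij_betw \<psi> V {1..1 + (k - 1) * Suc m}" by simp
    have on: "\<psi> ` e = \<phi> ` e" if "e \<in> ?E" for e
      using R.edge_sub[OF that] by (intro image_cong) (auto simp: \<psi>_def)
    have "\<psi> ` f = insert (\<psi> j) (\<psi> ` (f - {j}))" using j(1) by blast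
    also have "\<dots> = insert N {N + 1..N + (k - 1)}"
      using b1 \<phi>(4) by (simp add: bij_betw_def \<psi>_def N_def)
    also have "\<dots> = {N..N + (k - 1)}" by auto
    also have "\<dots> = loose_edge k (Suc m)" using k2 by (simp add: loose_edge_Suc N' N_def)
    finally have \<psi>f: "\<psi> ` f = loose_edge k (Suc m)" .
    have "(\<lambda>e. \<psi> ` e) ` E = insert (\<psi> ` f) ((\<lambda>e. \<psi> ` e) ` ?E)" using f by blast
    also have "(\<lambda>e. \<psi> ` e) ` ?E = loose_edge k ` {1..m}"
      unfolding \<phi>(2)[symmetric] using on by (rule image_cong[OF refl])
    also have "insert (\<psi> ` f) (loose_edge k ` {1..m}) = loose_edge k ` {1..Suc m}"
      by (simp add: \<psi>f atLeastAtMostSuc_conv)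
    finally have "(\<lambda>e. \<psi> ` e) ` E = loose_edge k ` {1..Suc m}" .
    moreover have "\<psi> z = 1 + (k - 1) * Suc m"
      unfolding N'[symmetric] using h(2) z j(2) by (simp add: \<psi>_def)
    ultimately show ?thesis using bij \<psi>f by blast
  qed
qed

context utree
begin

text \<open>Take the edge through which a vertex farthest from \<open>a\<close> is entered. All its
  vertices but the nearest are farthest too, so a further edge at one of them would lead farther
  still.\<close>

lemma pendant_edge_exists:
  assumes E: "E \<noteq> {}"
  obtains f j where "f \<in> E" "j \<in> f" "\<And>u. junction E f u \<Longrightarrow> u = j"
proof -
  have "V \<noteq> {}" using count by auto
  then obtain a where a: "a \<in> V" by blast
  obtain z where z: "z \<in> V" "\<And>b. b \<in> V \<Longrightarrow> d a b \<le> d a z"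
    using finite_obtains_max[OF fin \<open>V \<noteq> {}\<close>, of "d a"] by metis
  obtain e where e: "e \<in> E" using E by blast
  obtain b where b: "b \<in> e" "b \<noteq> a" using edge_other_vertex[OF e] .
  have "d a b \<noteq> 0" using d0[OF a edgeV[OF e b(1)]] b(2) by simp
  then have za: "a \<noteq> z" using z(2)[OF edgeV[OF e b(1)]] d0[OF a a] by auto
  obtain f w where f: "f \<in> E" "z \<in> f" "w \<in> f" "d a z = d a w + 1" using descent[OF a z(1) za] .
  obtain g where g: "g \<in> f" "a \<in> part f g" using part_exists[OF a f(1)] .
  have zg: "z \<noteq> g" using part_no_parent[OF g(2) f(3)] f(4) by blast
  have "u = g" if u: "junction E f u" for u
  proof (rule ccontr)
    assume ug: "u \<noteq> g"
    obtain e where e: "u \<in> f" "e \<in> E" "e \<noteq> f" "u \<in> e" using junctionE[OF u] .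
    have du: "d a u = d a g + 1" "d a z = d a g + 1"
      using partD[OF g(2)] e(1) ug f(2) zg by blast+
    have ua: "u \<noteq> a" using du(1) d0[OF a a] by auto
    have ae: "a \<in> part e u"
    proof (rule ccontr)
      assume "a \<notin> part e u"
      then obtain h where h: "h \<in> e" "d a u = d a h + 1" using not_partD[OF a e(2,4)] by metis
      show False
        using parent_unique[OF a edgeV[OF f(1) e(1)] ua e(2,4) h f(1) e(1) g(1) du(1)] e(3) by blast
    qed
    obtain t where t: "t \<in> e" "t \<noteq> u" using edge_other_vertex[OF e(2)] .
    have "d a t = d a u + 1" using partD[OF ae t] .
    then show False using z(2)[OF edgeV[OF e(2) t(1)]] du by simp
  qed
  then show thesis using that[OF f(1) g(1)] by blast
qed

lemma nonbranching_iso_loose_path: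
  assumes "E \<noteq> {}" "\<not> branching E"
  shows "hypergraph_iso \<lparr>verts = V, edges = E\<rparr> (loose_path (card V) k)"
proof -
  obtain f j where f: "f \<in> E" "j \<in> f" "\<And>u. junction E f u \<Longrightarrow> u = j"
    using pendant_edge_exists[OF assms(1)] by metis
  obtain z where z: "z \<in> f" "z \<noteq> j" using edge_other_vertex[OF f(1)] .
  obtain \<phi> where "bij_betw \<phi> V {1..1 + (k - 1) * card E}" "(\<lambda>e. \<phi> ` e) ` E = loose_edge k ` {1..card E}"
    using nonbranching_pendant_iso[OF utree_axioms assms(2) f(1) z(1) f(2) z(2)[symmetric] f(3) refl] by blast
  then show ?thesis
    unfolding hypergraph_iso_def count using loose_path_edges[OF k2, of "card E"]
    by (intro exI[of _ \<phi>]) simp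
qed

lemma attach_pendant_iso:
  assumes f: "f \<in> E" "v \<in> f" and pend: "\<And>u. junction E f u \<Longrightarrow> u = v"
    and \<phi>: "bij_betw \<phi> (V - (f - {v})) (verts P)" "(\<lambda>e. \<phi> ` e) ` (E - {f}) = edges P"
    and A: "finite A" "card A = k - 1" "verts P \<inter> A = {}"
  shows "hypergraph_iso \<lparr>verts = V, edges = E\<rparr> (attach_pendant P (\<phi> v) A)"
proof -
  interpret R: utree "V - (f - {v})" "E - {f}" k d by (rule utree_remove_pendant[OF f pend])
  have "card (f - {v}) = card A" using edge_card[OF f(1)] f(2) fin_edge[OF f(1)] A by simp
  then obtain h where h: "bij_betw h (f - {v}) A"
    using finite_same_card_bij[of "f - {v}" A] A fin_edge[OF f(1)] by auto
  define \<psi> where "\<psi> a = (if a \<in> f - {v} then h a else \<phi> a)" for a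
  have b1: "bij_betw \<psi> (f - {v}) A"
    using h by (rule bij_betw_cong[THEN iffD1, rotated]) (simp add: \<psi>_def)
  have b2: "bij_betw \<psi> (V - (f - {v})) (verts P)"
    using \<phi>(1) by (rule bij_betw_cong[THEN iffD1, rotated]) (auto simp: \<psi>_def)
  have "bij_betw \<psi> ((V - (f - {v})) \<union> (f - {v})) (verts P \<union> A)"
    by (rule bij_betw_combine[OF b2 b1 A(3)])
  moreover have "(V - (f - {v})) \<union> (f - {v}) = V" using edge_sub[OF f(1)] by blast
  ultimately have bij: "bij_betw \<psi> V (verts P \<union> A)" by simp
  have "\<psi> ` e = \<phi> ` e" if "e \<in> E - {f}" for e
    using R.edge_sub[OF that] by (intro image_cong) (auto simp: \<psi>_def)
  then have "(\<lambda>e. \<psi> ` e) ` (E - {f}) = edges P"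
    unfolding \<phi>(2)[symmetric] by (rule image_cong[OF refl])
  moreover have "\<psi> ` f = insert (\<phi> v) A"
  proof -
    have "\<psi> ` f = insert (\<psi> v) (\<psi> ` (f - {v}))" using f(2) by blast
    then show ?thesis using b1 by (simp add: bij_betw_def \<psi>_def)
  qed
  moreover have "(\<lambda>e. \<psi> ` e) ` E = insert (\<psi> ` f) ((\<lambda>e. \<psi> ` e) ` (E - {f}))" using f by blast
  ultimately have "(\<lambda>e. \<psi> ` e) ` E = insert (insert (\<phi> v) A) (edges P)" by simp
  then show ?thesis
    unfolding hypergraph_iso_def attach_pendant_def using bij by auto
qed

end

section \<open>Recognising the extremal hypertree\<close>

lemma loose_path_reverse:
  assumes k: "2 \<le> k" and i: "1 \<le> i" "i \<le> m"
  shows "(\<lambda>a. 2 + (k - 1) * m - a) ` loose_edge k i = loose_edge k (Suc m - i)"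
proof -
  obtain i' where i': "i = Suc i'" using i by (cases i) auto
  obtain l where l: "m = i' + Suc l" using i i' by (metis Suc_le_eq add_Suc_right less_imp_Suc_add)
  have "(\<lambda>a. n - a) ` {p..p + q} = {n - (p + q)..n - p}" if "p + q \<le> n" for n p q :: nat
  proof (intro equalityI subsetI)
    fix b assume "b \<in> {n - (p + q)..n - p}"
    then have "b = n - (n - b)" "n - b \<in> {p..p + q}" using that by auto
    then show "b \<in> (\<lambda>a. n - a) ` {p..p + q}" by blast
  qed auto
  note im = this
  define K where "K = k - 1"
  define n where "n = 2 + K * m"
  have n: "n = 2 + K * i' + K * l + K" by (simp add: n_def l algebra_simps)
  have "loose_edge k i = {1 + K * i'..(1 + K * i') + K}"
    unfolding i' loose_edge_Suc[OF k] K_def[symmetric] by (simp add: add_ac)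
  moreover have "Suc m - i = Suc l" by (simp add: i' l)
  then have "loose_edge k (Suc m - i) = {1 + K * l..1 + K * l + K}"
    unfolding K_def by (simp add: loose_edge_Suc[OF k] add_ac)
  moreover have "(\<lambda>a. n - a) ` {1 + K * i'..(1 + K * i') + K} = {n - ((1 + K * i') + K)..n - (1 + K * i')}"
    by (rule im) (simp add: n)
  moreover have "n - ((1 + K * i') + K) = 1 + K * l" "n - (1 + K * i') = 1 + K * l + K"
    by (simp_all add: n)
  moreover have "(\<lambda>a. 2 + (k - 1) * m - a) = (\<lambda>a. n - a)" by (simp add: n_def K_def)
  ultimately show ?thesis by (simp only:)
qed

text \<open>One edge of the star prolongs the path and the other is the pendant edge. This brings
  \<open>k = 2\<close> into the form used for \<open>k >= 3\<close>.\<close>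

lemma F_hypertree_2:
  assumes n: "5 \<le> n"
  shows "F_hypertree n 2 = attach_pendant (loose_path (n - 1) 2) (n - 2) {n}"
proof -
  define m where "m = n - 3"
  then have m: "n = m + 3" using n by simp
  have F: "F_hypertree n 2 = \<lparr>verts = {1..m + 1} \<union> {m + 1, m + 2, m + 3},
      edges = loose_edge 2 ` {1..m} \<union> {{m + 1, m + 2}, {m + 1, m + 3}}\<rparr>"
    by (simp add: F_hypertree_def hunion_def star_def loose_path_def m)
  have P: "loose_path (n - 1) 2 = \<lparr>verts = {1..m + 2}, edges = loose_edge 2 ` {1..m + 1}\<rparr>"
    by (simp add: loose_path_def m)
  have A: "attach_pendant (loose_path (n - 1) 2) (n - 2) {n} = \<lparr>verts = {1..m + 2} \<union> {m + 3},
      edges = insert {m + 1, m + 3} (loose_edge 2 ` {1..m + 1})\<rparr>"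
    unfolding attach_pendant_def P by (simp add: m)
  have "loose_edge 2 (m + 1) = {m + 1, m + 2}" by (auto simp: loose_edge_def)
  moreover have "{1..m + 1} = insert (m + 1) {1..m}" by auto
  ultimately have "loose_edge 2 ` {1..m + 1} = insert {m + 1, m + 2} (loose_edge 2 ` {1..m})" by simp
  moreover have "{1..m + 1} \<union> {m + 1, m + 2, m + 3} = {1..m + 2} \<union> {m + 3}" by auto
  ultimately show ?thesis unfolding F A by auto
qed

context maximal_utree
begin

lemma iso_F_hypertree:
  assumes "branching E"
  shows "hypergraph_iso \<lparr>verts = V, edges = E\<rparr> (F_hypertree (card V) k)"
proof (cases "\<exists>v. branching_vertex E v")
  case True
  then obtain v0 where "branching_vertex E v0" by blast
  then obtain v e1 e2 where s: "k = 2" "e1 \<in> E" "e2 \<in> E" "e1 \<noteq> e2" "v \<in> e1" "v \<in> e2"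
    "\<forall>u. junction E e1 u \<longrightarrow> u = v" "\<forall>u. junction E e2 u \<longrightarrow> u = v" "\<not> branching (E - {e1})"
    by (rule branching_vertex_structure)
  have pend: "u = v" if "junction E e1 u" for u using s(7) that by blast
  let ?V = "V - (e1 - {v})" and ?E = "E - {e1}"
  interpret R: utree ?V ?E k d by (rule utree_remove_pendant[OF s(2,5) pend])
  obtain z where z: "z \<in> e2" "z \<noteq> v" using edge_other_vertex[OF s(3)] .
  have "u = v" if "junction ?E e2 u" for u using s(8) junction_mono[OF that] by blast
  then obtain \<phi> where \<phi>: "bij_betw \<phi> ?V {1..1 + (k - 1) * card ?E}"
    "(\<lambda>e. \<phi> ` e) ` ?E = loose_edge k ` {1..card ?E}"
    "\<phi> ` e2 = loose_edge k (card ?E)" "\<phi> z = 1 + (k - 1) * card ?E"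
    using nonbranching_pendant_iso[OF R.utree_axioms s(9) _ z(1) s(6) z(2)[symmetric] _ refl] s(3,4) by blast
  define m where "m = card ?E"
  have cE: "card E = Suc m" using s(2) finE four by (simp add: m_def)
  then have cV: "card V = m + 2" using count s(1) by simp
  have e2V: "v \<in> ?V" "z \<in> ?V" using R.edgeV[of e2 v] R.edgeV[of e2 z] s(3,4,6) z(1) by blast+
  have "\<phi> v \<noteq> \<phi> z" using \<phi>(1) e2V z(2) by (metis bij_betw_imp_inj_on inj_on_eq_iff)
  moreover have "\<phi> v \<in> loose_edge k m" using \<phi>(3) s(6) m_def by blast
  \<comment> \<open>The last edge is \<open>{m, m + 1}\<close>, and its end \<open>m + 1\<close> is
    taken by \<open>z\<close>.\<close>
  ultimately have \<phi>v: "\<phi> v = m" using \<phi>(4) s(1) cE four by (auto simp: loose_edge_def m_def)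
  let ?P = "loose_path (1 + (k - 1) * m) k"
  have "hypergraph_iso \<lparr>verts = V, edges = E\<rparr> (attach_pendant ?P (\<phi> v) {card V})"
  proof (rule attach_pendant_iso[OF s(2,5) pend])
    show "bij_betw \<phi> ?V (verts ?P)" "(\<lambda>e. \<phi> ` e) ` ?E = edges ?P"
      using \<phi>(1,2) loose_path_edges[OF k2, of m] by (simp_all add: m_def)
    show "card {card V} = k - 1" "verts ?P \<inter> {card V} = {}"
      using s(1) cV loose_path_edges(2)[OF k2, of m] by auto
    show "finite {card V}" by (rule finite.intros(2)[OF finite.emptyI])
  qed
  moreover have "F_hypertree (card V) k = attach_pendant ?P (\<phi> v) {card V}"
    using F_hypertree_2[of "card V"] cV cE four s(1) \<phi>v by simp
  ultimately show ?thesis by simp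
next
  case False
  then obtain e0 where e0: "e0 \<in> E" "branching_edge E e0" using assms unfolding branching_def by blast
  have nov: "\<not> branching_vertex E v" for v using False by blast
  obtain e v1 v2 e1 e2 where s: "3 \<le> k" "e \<in> E" "e1 \<in> E" "e2 \<in> E" "e1 \<noteq> e" "e2 \<noteq> e" "e1 \<noteq> e2"
    "v1 \<in> e" "v1 \<in> e1" "v2 \<in> e" "v2 \<in> e2" "v1 \<noteq> v2"
    "\<forall>u. junction E e1 u \<longrightarrow> u = v1" "\<forall>u. junction E e2 u \<longrightarrow> u = v2"
    "\<forall>f\<in>E. v1 \<in> f \<longrightarrow> f = e \<or> f = e1" "\<not> branching (E - {e1})"
    using branching_edge_structure[OF nov e0] .
  have pend: "u = v1" if "junction E e1 u" for u using s(13) that by blast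
  let ?V = "V - (e1 - {v1})" and ?E = "E - {e1}"
  interpret R: utree ?V ?E k d by (rule utree_remove_pendant[OF s(3,9) pend])
  obtain z where z: "z \<in> e2" "z \<noteq> v2" using edge_other_vertex[OF s(4)] .
  have "u = v2" if "junction ?E e2 u" for u using s(14) junction_mono[OF that] by blast
  then obtain \<phi> where \<phi>: "bij_betw \<phi> ?V {1..1 + (k - 1) * card ?E}"
    "(\<lambda>e. \<phi> ` e) ` ?E = loose_edge k ` {1..card ?E}" "\<phi> ` e2 = loose_edge k (card ?E)"
    using nonbranching_pendant_iso[OF R.utree_axioms s(16) _ z(1) s(11) z(2)[symmetric] _ refl] s(4,7) by blast
  define m where "m = card ?E"
  have cE: "card E = Suc m" using s(3) finE four by (simp add: m_def)
  then have m3: "3 \<le> m" using four by simp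
  define N where "N = 1 + (k - 1) * m"
  have cV: "card V = N + (k - 1)" using count cE by (simp add: N_def)
  let ?P = "loose_path N k"
  have P: "edges ?P = loose_edge k ` {1..m}" "verts ?P = {1..N}"
    using loose_path_edges[OF k2, of m] by (simp_all add: N_def)
  \<comment> \<open>So far \<open>e2\<close> is the last edge. The reflection \<open>r\<close> makes
    it the first one, so that \<open>e\<close>, which shares \<open>v2\<close> with it, becomes the
    second, where \<open>F\<close> has its pendant edge.\<close>
  define r where "r a = 2 + (k - 1) * m - a" for a
  have r: "bij_betw r {1..N} {1..N}"
    by (rule bij_betw_byWitness[of _ r]) (auto simp: r_def N_def)
  have rE: "r ` loose_edge k i = loose_edge k (Suc m - i)" if "1 \<le> i" "i \<le> m" for i
    using loose_path_reverse[OF k2 that] by (simp add: r_def[abs_def])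
  define \<chi> where "\<chi> = r \<circ> \<phi>"
  have \<chi>: "bij_betw \<chi> ?V {1..N}"
    unfolding \<chi>_def using \<phi>(1) r by (intro bij_betw_trans) (simp_all add: N_def m_def)
  have "(\<lambda>i. loose_edge k (Suc m - i)) ` {1..m} = loose_edge k ` {1..m}"
  proof (intro equalityI subsetI)
    fix g assume "g \<in> loose_edge k ` {1..m}"
    then obtain i where i: "i \<in> {1..m}" "g = loose_edge k i" by blast
    then have "g = loose_edge k (Suc m - (Suc m - i))" "Suc m - i \<in> {1..m}" by auto
    then show "g \<in> (\<lambda>i. loose_edge k (Suc m - i)) ` {1..m}" by blast
  next
    fix g assume "g \<in> (\<lambda>i. loose_edge k (Suc m - i)) ` {1..m}"
    then obtain i where "i \<in> {1..m}" "g = loose_edge k (Suc m - i)" by blast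
    moreover from this have "Suc m - i \<in> {1..m}" by auto
    ultimately show "g \<in> loose_edge k ` {1..m}" by blast
  qed
  moreover have "(\<lambda>e. \<chi> ` e) ` ?E = (\<lambda>g. r ` g) ` loose_edge k ` {1..m}"
    unfolding \<chi>_def using \<phi>(2)[folded m_def] by (metis (no_types, lifting) image_comp image_cong image_image)
  moreover have "(\<lambda>g. r ` g) ` loose_edge k ` {1..m} = (\<lambda>i. loose_edge k (Suc m - i)) ` {1..m}"
    unfolding image_image by (rule image_cong) (use rE in auto)
  ultimately have \<chi>E: "(\<lambda>e. \<chi> ` e) ` ?E = loose_edge k ` {1..m}" by simp
  have \<chi>2: "\<chi> ` e2 = loose_edge k 1"
  proof -
    have "\<chi> ` e2 = r ` \<phi> ` e2" by (simp add: \<chi>_def image_image)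
    then show ?thesis using \<phi>(3) rE[of m] m3 by (simp add: m_def)
  qed
  have inj: "inj_on \<chi> ?V" using \<chi> by (simp add: bij_betw_def)
  have eE: "e \<in> ?E" "e2 \<in> ?E" using s by auto
  have sub: "e \<subseteq> ?V" "e2 \<subseteq> ?V" using R.edge_sub eE by auto
  have "\<chi> ` e \<in> loose_edge k ` {1..m}" unfolding \<chi>E[symmetric] using eE(1) by (rule imageI)
  then obtain i where i: "i \<in> {1..m}" "\<chi> ` e = loose_edge k i" by (elim imageE) metis
  have "i \<noteq> 1" using i(2) \<chi>2 inj_on_image_eq_iff[OF inj sub] s(6) by metis
  moreover have "i \<le> 2"
  proof (rule ccontr)
    assume "\<not> i \<le> 2"
    then have "2 * (k - 1) \<le> (i - 1) * (k - 1)" by (intro mult_le_mono1) simp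
    moreover have "\<chi> v2 \<in> loose_edge k i" "\<chi> v2 \<in> loose_edge k 1" using i(2) \<chi>2 s(10,11) by blast+
    then have "(i - 1) * (k - 1) + 1 \<le> \<chi> v2" "\<chi> v2 \<le> k" by (simp_all add: loose_edge_def)
    ultimately show False using s(1) by linarith
  qed
  ultimately have i2: "i = 2" using i(1) by auto
  have only: "g = e" if "g \<in> ?E" "v1 \<in> g" for g using s(15) that by blast
  define w where "w = \<chi> v1"
  have w: "{g \<in> edges ?P. w \<in> g} = {loose_edge k 2}"
  proof -
    have "\<chi> ` g = loose_edge k 2" if "g \<in> ?E" "\<chi> v1 \<in> \<chi> ` g" for g
    proof -
      have "v1 \<in> g" using that inj_on_image_mem_iff[OF inj, of v1 g] R.edge_sub[OF that(1)] sub s(8) by blast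
      then show ?thesis using only[OF that(1)] i i2 by blast
    qed
    moreover have "\<chi> v1 \<in> \<chi> ` e" "\<chi> ` e = loose_edge k 2" using s(8) i i2 by auto
    ultimately show ?thesis unfolding P(1) \<chi>E[symmetric] w_def using eE(1) by blast
  qed
  define w0 where "w0 = (SOME w. w \<in> loose_edge k 2 \<and> hdegree ?P w = 1)"
  have "w \<in> loose_edge k 2 \<and> hdegree ?P w = 1" using w by (auto simp: hdegree_def)
  then have w0: "w0 \<in> loose_edge k 2 \<and> hdegree ?P w0 = 1" unfolding w0_def by (rule someI)
  have w0': "{g \<in> edges ?P. w0 \<in> g} = {loose_edge k 2}"
  proof -
    obtain g where g: "{g \<in> edges ?P. w0 \<in> g} = {g}"
      using w0 unfolding hdegree_def by (metis card_1_singletonE)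
    moreover have "loose_edge k 2 \<in> {g \<in> edges ?P. w0 \<in> g}" using w w0 by blast
    ultimately show ?thesis by auto
  qed
  \<comment> \<open>\<open>F\<close> is built with an unspecified choice \<open>w0\<close>. Both
    \<open>w\<close> and \<open>w0\<close> lie in the second edge only, so exchanging them fixes
    every edge of the path.\<close>
  define \<tau> where "\<tau> = transpose w w0"
  have "loose_edge k 2 \<in> edges ?P" using w by blast
  then have "loose_edge k 2 \<subseteq> {1..N}" using i i2 \<chi> sub(1) by (metis bij_betw_def image_mono)
  then have wN: "w \<in> {1..N}" "w0 \<in> {1..N}" using w w0 by blast+
  have \<tau>: "\<tau> ` g = g" if "g \<in> edges ?P" for g
  proof -
    have "w \<in> g \<longleftrightarrow> w0 \<in> g" using w w0' that by blast
    then show ?thesis by (simp add: \<tau>_def)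
  qed
  have "bij_betw \<tau> {1..N} {1..N}" unfolding \<tau>_def using wN by (simp add: bij_betw_transpose_iff)
  then have bij: "bij_betw (\<tau> \<circ> \<chi>) ?V (verts ?P)" unfolding P(2) by (rule bij_betw_trans[OF \<chi>])
  have "(\<lambda>e. (\<tau> \<circ> \<chi>) ` e) ` ?E = (\<lambda>g. \<tau> ` g) ` (\<lambda>e. \<chi> ` e) ` ?E"
    by (simp add: image_image image_comp)
  also have "\<dots> = (\<lambda>g. \<tau> ` g) ` edges ?P" by (simp only: \<chi>E P(1))
  also have "\<dots> = edges ?P" using \<tau> by simp
  finally have edg: "(\<lambda>e. (\<tau> \<circ> \<chi>) ` e) ` ?E = edges ?P" .
  have "hypergraph_iso \<lparr>verts = V, edges = E\<rparr> (attach_pendant ?P ((\<tau> \<circ> \<chi>) v1) {N + 1..N + (k - 1)})"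
    by (rule attach_pendant_iso[OF s(3,9) pend bij edg]) (auto simp: P(2))
  moreover have "(\<tau> \<circ> \<chi>) v1 = w0" by (simp add: \<tau>_def w_def)
  moreover have "card V - k + 1 = N" "card V - k + 2 = N + 1" using cV s(1) by (simp_all add: N_def)
  then have "F_hypertree (card V) k = attach_pendant ?P w0 {N + 1..N + (k - 1)}"
    using s(1) cV by (simp add: F_hypertree_def w0_def)
  ultimately show ?thesis by simp
qed

end

section \<open>Acyclic connected hypergraphs\<close>

lemma adjacency_rtrancl_sym: "(a, b) \<in> (adjacency E)\<^sup>* \<Longrightarrow> (b, a) \<in> (adjacency E)\<^sup>*"
  using sym_rtrancl[of "adjacency E"] by (auto simp: sym_def adjacency_def)

lemma walk_reachable:
  assumes "walk G vs es" "i \<le> length es"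
  shows "(hd vs, vs ! i) \<in> (adjacency (edges G))\<^sup>*"
  using assms(2)
proof (induction i)
  case 0
  have "vs \<noteq> []" using assms(1) by (auto simp: walk_def)
  then show ?case by (simp add: hd_conv_nth)
next
  case (Suc i)
  then have "es ! i \<in> edges G" "vs ! i \<in> es ! i" "vs ! Suc i \<in> es ! i"
    using assms(1) by (auto simp: walk_def subset_iff)
  then have "(vs ! i, vs ! Suc i) \<in> adjacency (edges G)" unfolding adjacency_def by blast
  then show ?case using Suc by (simp add: rtrancl_into_rtrancl)
qed

lemma adjacency_subset:
  assumes "(a, b) \<in> (adjacency E)\<^sup>*" "a \<in> V" "\<And>e. e \<in> E \<Longrightarrow> e \<subseteq> V"
  shows "b \<in> V"
  using assms(1) by induction (use assms(2,3) in \<open>auto simp: adjacency_def\<close>)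

lemma connected_reachable:
  assumes "connected_hypergraph G" "a \<in> verts G" "b \<in> verts G"
  shows "(a, b) \<in> (adjacency (edges G))\<^sup>*"
proof -
  obtain vs es where p: "walk G vs es" "hd vs = a" "last vs = b"
    using assms unfolding connected_hypergraph_def path_between_def is_path_def by metis
  then have "vs \<noteq> []" "length vs = Suc (length es)" by (auto simp: walk_def)
  then have "last vs = vs ! length es" by (simp add: last_conv_nth)
  then show ?thesis using walk_reachable[OF p(1), of "length es"] p by simp
qed

text \<open>A path from \<open>w1\<close> to \<open>w2\<close> that avoids \<open>e\<close> would be
  closed to a cycle by \<open>e\<close>.\<close>

lemma hypertree_edge_separates:
  assumes T: "hypertree G" and e: "e \<in> edges G" "w1 \<in> e" "w2 \<in> e" "w1 \<noteq> w2"
  shows "(w1, w2) \<notin> (adjacency (edges G - {e}))\<^sup>*"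
proof
  let ?A = "adjacency (edges G - {e})" and ?W = "{b. (w1, b) \<in> (adjacency (edges G - {e}))\<^sup>*}"
  assume r: "(w1, w2) \<in> ?A\<^sup>*"
  have sub: "f \<subseteq> verts G" if "f \<in> edges G" for f using T that by (auto simp: hypertree_def wf_hypergraph_def)
  have w: "w1 \<in> verts G" "w2 \<in> verts G" using sub e by auto
  have W: "?W \<subseteq> verts G" using adjacency_subset[OF _ w(1), of _ "edges G - {e}"] sub by blast
  have "w2 \<in> ?W" "w1 \<in> ?W" using r by auto
  then obtain vs es where p: "path_between G w1 w2 vs es" "set es \<subseteq> edges G - {e}"
    using dist_from_path[OF dist_from_adjacency W Diff_subset] by metis
  then have p': "walk G vs es" "distinct vs" "distinct es" "hd vs = w1" "last vs = w2" "e \<notin> set es"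
    by (auto simp: path_between_def is_path_def)
  have l: "length vs = Suc (length es)" using p' by (simp add: walk_def)
  have ne: "vs \<noteq> []" using l by auto
  have lw: "vs ! length es = w2" using p'(5) ne l by (simp add: last_conv_nth)
  have "walk G (vs @ [w1]) (es @ [e])"
    unfolding walk_def
  proof (intro conjI allI impI)
    fix i assume i: "i < length (es @ [e])"
    have "(vs @ [w1]) ! i \<in> (es @ [e]) ! i \<and> (vs @ [w1]) ! Suc i \<in> (es @ [e]) ! i \<and>
      (vs @ [w1]) ! i \<noteq> (vs @ [w1]) ! Suc i"
    proof (cases "i < length es")
      case True
      then have "(vs @ [w1]) ! i = vs ! i" "(vs @ [w1]) ! Suc i = vs ! Suc i" "(es @ [e]) ! i = es ! i"
        using l by (simp_all add: nth_append)
      then show ?thesis using p'(1) True unfolding walk_def by simp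
    next
      case False
      then have "(vs @ [w1]) ! i = w2" "(vs @ [w1]) ! Suc i = w1" "(es @ [e]) ! i = e"
        using i l lw by (auto simp: nth_append less_Suc_eq)
      then show ?thesis using e by auto
    qed
    then show "(vs @ [w1]) ! i \<in> (es @ [e]) ! i" "(vs @ [w1]) ! Suc i \<in> (es @ [e]) ! i"
      "(vs @ [w1]) ! i \<noteq> (vs @ [w1]) ! Suc i" by blast+
  qed (use p' l e w in \<open>auto simp: walk_def\<close>)
  moreover have "es \<noteq> []" using lw p'(4) e(4) ne by (auto simp: hd_conv_nth)
  then have "2 \<le> length (es @ [e])" by (cases es) auto
  ultimately have "is_cycle G (vs @ [w1]) (es @ [e])"
    using p' ne by (simp add: is_cycle_def)
  then show False using T by (auto simp: hypertree_def)
qed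

text \<open>Double counting of pairs of a vertex \<open>b\<close> and an edge containing
  \<open>b\<close> and a vertex one step nearer to \<open>a\<close>. Acyclicity gives each vertex
  but \<open>a\<close> exactly one such edge and each edge exactly \<open>k - 1\<close> such
  vertices.\<close>

lemma hypertree_card_edges:
  fixes G :: "'a hypergraph"
  assumes T: "hypertree G" and u: "uniform k G" and k: "2 \<le> k" and a: "a \<in> verts G"
    and r: "dist_from (verts G) (edges G) a r"
  shows "card (verts G) = 1 + (k - 1) * card (edges G)"
proof -
  let ?V = "verts G" and ?E = "edges G"
  define R where "R b e \<longleftrightarrow> b \<in> e \<and> (\<exists>w\<in>e. r b = r w + 1)" for b e
  have wf: "finite ?V" and sub: "\<And>e. e \<in> ?E \<Longrightarrow> e \<subseteq> ?V" and ne: "\<And>e. e \<in> ?E \<Longrightarrow> e \<noteq> {}"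
    using T by (auto simp: hypertree_def wf_hypergraph_def)
  have finE: "finite ?E" using wf sub by (meson Pow_iff finite_Pow_iff finite_subset subsetI)
  have fe: "finite e" if "e \<in> ?E" for e using sub[OF that] wf finite_subset by blast
  have r0: "r b = 0 \<longleftrightarrow> b = a" if "b \<in> ?V" for b using r that by (auto simp: dist_from_def)
  have lip: "r w' \<le> r w + 1" if "e \<in> ?E" "w \<in> e" "w' \<in> e" for e w w'
  proof -
    have "w \<in> e \<inter> ?V" "w' \<in> e \<inter> ?V" using sub that by auto
    then show ?thesis using r that(1) unfolding dist_from_def by blast
  qed
  have desc: "\<exists>e\<in>?E. R b e" if "b \<in> ?V" "b \<noteq> a" for b
    using r that unfolding dist_from_def R_def by blast
  \<comment> \<open>The descent from \<open>b\<close> to \<open>a\<close> cannot use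
    \<open>e\<close>: it would need a vertex of \<open>e\<close> with a smaller value of
    \<open>r\<close> than \<open>b\<close>.\<close>
  have avoid: "(a, b) \<in> (adjacency (?E - {e}))\<^sup>*"
    if "b \<in> ?V" "\<And>w. w \<in> e \<Longrightarrow> r b \<le> r w" for b e
    using that
  proof (induction "r b" arbitrary: b rule: less_induct)
    case less
    show ?case
    proof (cases "b = a")
      case False
      then obtain f w where f: "f \<in> ?E" "b \<in> f" "w \<in> f" "r b = r w + 1"
        using desc[OF less.prems(1)] by (auto simp: R_def)
      have "f \<noteq> e" using less.prems(2)[of w] f by auto
      then have "(w, b) \<in> adjacency (?E - {e})" using f by (auto simp: adjacency_def)
      moreover have "(a, w) \<in> (adjacency (?E - {e}))\<^sup>*"
        using less.hyps[of w] f sub less.prems(2) by fastforce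
      ultimately show ?thesis by (rule rtrancl_into_rtrancl[rotated])
    qed simp
  qed
  have cE: "card {b \<in> ?V - {a}. R b e} = k - 1" if e: "e \<in> ?E" for e
  proof -
    obtain g where g: "g \<in> e" "\<And>w. w \<in> e \<Longrightarrow> r g \<le> r w"
      using arg_min_if_finite[OF fe[OF e] ne[OF e], of r] by (metis not_le)
    have "R w e" if w: "w \<in> e" "w \<noteq> g" for w
    proof (rule ccontr)
      assume "\<not> R w e"
      then have "r w \<noteq> r g + 1" using w g(1) by (auto simp: R_def)
      then have "r w \<le> r g" using lip[OF e g(1) w(1)] by simp
      then have "(a, w) \<in> (adjacency (?E - {e}))\<^sup>*" "(a, g) \<in> (adjacency (?E - {e}))\<^sup>*"
        using avoid[of w e] avoid[of g e] g sub[OF e] w by fastforce+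
      then have "(w, g) \<in> (adjacency (?E - {e}))\<^sup>*"
        using adjacency_rtrancl_sym rtrancl_trans by metis
      then show False using hypertree_edge_separates[OF T e w(1) g(1) w(2)] by blast
    qed
    moreover have "\<not> R g e" using g(2) by (force simp: R_def)
    moreover have "\<not> R a e" using r0[OF a] by (auto simp: R_def)
    ultimately have "{b \<in> ?V - {a}. R b e} = e - {g}" using sub[OF e] by (auto simp: R_def)
    then show ?thesis using g(1) fe[OF e] u e by (simp add: uniform_def)
  qed
  have cV: "card {e \<in> ?E. R b e} = 1" if b: "b \<in> ?V - {a}" for b
  proof -
    obtain e where e: "e \<in> ?E" "R b e" using desc b by blast
    have "f = e" if f: "f \<in> ?E" "R b f" for f
    proof (rule ccontr)
      assume fe: "f \<noteq> e"
      obtain g where g: "b \<in> e" "g \<in> e" "r b = r g + 1" using e by (auto simp: R_def)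
      obtain h where h: "b \<in> f" "h \<in> f" "r b = r h + 1" using f by (auto simp: R_def)
      have "r g \<le> r w" "r h \<le> r w" if "w \<in> e" for w
        using lip[OF e(1) that g(1)] g(3) h(3) by simp_all
      then have "(a, g) \<in> (adjacency (?E - {e}))\<^sup>*" "(a, h) \<in> (adjacency (?E - {e}))\<^sup>*"
        using avoid g(2) h(2) sub e(1) f(1) by (metis subsetD)+
      moreover have "(h, b) \<in> adjacency (?E - {e})"
        using f(1) fe h by (auto simp: adjacency_def)
      ultimately have "(g, b) \<in> (adjacency (?E - {e}))\<^sup>*"
        using adjacency_rtrancl_sym rtrancl_trans rtrancl_into_rtrancl by metis
      then show False using hypertree_edge_separates[OF T e(1) g(2,1)] g(3) by fastforce
    qed
    then have "{e \<in> ?E. R b e} = {e}" using e by blast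
    then show ?thesis by simp
  qed
  have "(\<Sum>b\<in>?V - {a}. card {e \<in> ?E. R b e}) = (\<Sum>e\<in>?E. card {b \<in> ?V - {a}. R b e})"
    using sum.swap_restrict[of "?V - {a}" ?E "\<lambda>_ _. 1::nat" R] wf finE by simp
  then have "card (?V - {a}) = (k - 1) * card ?E" using cE cV by (simp add: mult.commute)
  then show ?thesis using a wf by (metis card_Suc_Diff1 plus_1_eq_Suc)
qed

lemma hypertree_utree:
  assumes T: "hypertree G" and u: "uniform k G" and k: "2 \<le> k"
  obtains d where "utree (verts G) (edges G) k d"
proof -
  define d where "d a b = (LEAST n. (a, b) \<in> adjacency (edges G) ^^ n)" for a b
  have wf: "finite (verts G)" "verts G \<noteq> {}" and sub: "\<And>e. e \<in> edges G \<Longrightarrow> e \<subseteq> verts G"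
    and con: "connected_hypergraph G"
    using T by (auto simp: hypertree_def wf_hypergraph_def)
  have dist: "dist_from (verts G) (edges G) a (d a)" if a: "a \<in> verts G" for a
  proof -
    have "{b. (a, b) \<in> (adjacency (edges G))\<^sup>*} = verts G"
      using adjacency_subset[OF _ a sub] connected_reachable[OF con a] by blast
    then show ?thesis
      using dist_from_adjacency[of a "edges G"] by (simp add: d_def[abs_def])
  qed
  obtain a where "a \<in> verts G" using wf by blast
  then have "utree (verts G) (edges G) k d"
    using wf sub k dist u hypertree_card_edges[OF T u k _ dist] by unfold_locales (auto simp: uniform_def)
  then show thesis by (rule that)
qed

section \<open>Isomorphism invariance\<close>

text \<open>Distances are transported along the isomorphism as a \<open>dist_from\<close>
  certificate, so nothing about \<open>H\<close> has to be known beforehand; this is how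
  \<open>F\<close> is reached.\<close>

lemma (in utree) radius_iso:
  assumes "hypergraph_iso \<lparr>verts = V, edges = E\<rparr> H"
  shows "distance_spectral_radius H = radius"
proof -
  obtain f where f: "bij_betw f V (verts H)" "(\<lambda>e. f ` e) ` E = edges H"
    using assms by (auto simp: hypergraph_iso_def)
  define g where "g = inv_into V f"
  have inj: "inj_on f V" and im: "f ` V = verts H" using f(1) by (auto simp: bij_betw_def)
  have gf: "g (f a) = a" if "a \<in> V" for a using inj that by (simp add: g_def)
  have fin_H: "finite (verts H)" using im fin by (metis finite_imageI)
  have dH: "hdist H (f a) (f b) = d a b" if a: "a \<in> V" and b: "b \<in> V" for a b
  proof -
    have "dist_from (verts H) (edges H) (f a) (\<lambda>p. d a (g p))"
      unfolding dist_from_def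
    proof (intro conjI ballI impI)
      fix p assume "p \<in> verts H"
      then obtain b where b: "b \<in> V" "p = f b" using im by blast
      then show "d a (g p) = 0 \<longleftrightarrow> p = f a" using gf d0[OF a] inj a by (auto simp: inj_on_eq_iff)
      assume "p \<noteq> f a"
      then obtain e w where e: "e \<in> E" "b \<in> e" "w \<in> e" "d a b = d a w + 1"
        using descent[OF a b(1)] b by metis
      then show "\<exists>e\<in>edges H. p \<in> e \<and> (\<exists>w\<in>e \<inter> verts H. d a (g p) = d a (g w) + 1)"
        using f(2) b gf edgeV im by (intro bexI[of _ "f ` e"] conjI bexI[of _ "f w"]) auto
    next
      fix e p q assume "e \<in> edges H" "p \<in> e \<inter> verts H" "q \<in> e \<inter> verts H"
      then obtain e' p' q' where "e' \<in> E" "p' \<in> e'" "p = f p'" "q' \<in> e'" "q = f q'"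
        unfolding f(2)[symmetric] by blast
      then show "d a (g q) \<le> d a (g p) + 1" using lip[OF a] gf edgeV by auto
    qed
    from hdist_eq_dist_from[OF this, of "f b"] show ?thesis using a b im gf by auto
  qed
  let ?G = "\<lparr>verts = V, edges = E\<rparr>"
  have sH: "(\<Sum>v\<in>verts H. real (hdist H (f u) v) * y v) = (\<Sum>v\<in>V. real (hdist ?G u v) * y (f v))"
    if "u \<in> V" for u and y :: "_ \<Rightarrow> real"
    unfolding sum.reindex_bij_betw[OF f(1), symmetric] using dH hdist that by (intro sum.cong) auto
  have "eigenvalue (distance_matrix H) c \<longleftrightarrow> eigenvalue (distance_matrix ?G) c" for c
  proof
    assume "eigenvalue (distance_matrix H) c"
    then obtain y where y: "\<exists>v\<in>verts H. y v \<noteq> 0"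
      "\<forall>u\<in>verts H. (\<Sum>v\<in>verts H. real (hdist H u v) * y v) = c * y u"
      unfolding eigenvalue_distance_matrix_iff[OF fin_H] by blast
    have "(\<Sum>v\<in>V. real (hdist ?G u v) * y (f v)) = c * y (f u)" if "u \<in> V" for u
    proof -
      have "f u \<in> verts H" using im that by blast
      then show ?thesis using y(2) sH[OF that, of y] by simp
    qed
    moreover have "\<exists>v\<in>V. y (f v) \<noteq> 0" using y(1) unfolding im[symmetric] by blast
    ultimately show "eigenvalue (distance_matrix ?G) c"
      using eigenvalue_distance_matrix_iff[of ?G c] fin by auto
  next
    assume "eigenvalue (distance_matrix ?G) c"
    then obtain x where x: "\<exists>v\<in>V. x v \<noteq> 0"
      "\<forall>u\<in>V. (\<Sum>v\<in>V. real (hdist ?G u v) * x v) = c * x u"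
      using eigenvalue_distance_matrix_iff[of ?G c] fin by auto
    have "(\<Sum>v\<in>verts H. real (hdist H (f u) v) * x (g v)) = c * x (g (f u))" if "u \<in> V" for u
      using sH[OF that, of "\<lambda>v. x (g v)"] x(2) that gf by simp
    then have "\<forall>u\<in>verts H. (\<Sum>v\<in>verts H. real (hdist H u v) * x (g v)) = c * x (g u)"
      unfolding im[symmetric] by simp
    moreover obtain v where "v \<in> V" "x v \<noteq> 0" using x(1) by blast
    then have "f v \<in> verts H" "x (g (f v)) \<noteq> 0" using im gf by auto
    then have "\<exists>v\<in>verts H. x (g v) \<noteq> 0" by (rule bexI[rotated])
    ultimately show "eigenvalue (distance_matrix H) c"
      unfolding eigenvalue_distance_matrix_iff[OF fin_H] by (intro exI[of _ "\<lambda>v. x (g v)"] conjI)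
  qed
  then show ?thesis by (simp add: distance_spectral_radius_def)
qed

theorem theorem4p3:
  fixes T :: "'a hypergraph" and n k :: nat
  assumes "2 \<le> k"
    and "hypertree T"
    and "uniform k T"
    and "card (verts T) = n"
    and "\<not> hypergraph_iso T (loose_path n k)"
    and "(real n - 1) / (real k - 1) \<ge> 4"
  shows "distance_spectral_radius T \<le> distance_spectral_radius (F_hypertree n k) \<and>
    (distance_spectral_radius T = distance_spectral_radius (F_hypertree n k) \<longleftrightarrow>
      hypergraph_iso T (F_hypertree n k))"
proof -
  obtain V E where T: "T = \<lparr>verts = V, edges = E\<rparr>" by (cases T) auto
  obtain d where "utree (verts T) (edges T) k d" using hypertree_utree[OF assms(2,3,1)] .
  then interpret utree V E k d by (simp add: T)
  have n: "n = card V" using assms(4) T by simp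
  have "real n - 1 = (real k - 1) * real (card E)" using n count assms(1) by (simp add: of_nat_diff)
  then have m: "4 \<le> card E" using assms(1,6) by simp
  then have "E \<noteq> {}" by auto
  then have br: "branching E" using nonbranching_iso_loose_path assms(5) n T by blast
  define \<rho> where "\<rho> E' = distance_spectral_radius \<lparr>verts = V, edges = E'\<rparr>" for E'
  let ?S = "{E'. branching E' \<and> (\<exists>d'. utree V E' k d')}"
  have S: "finite ?S"
  proof (rule finite_subset)
    show "?S \<subseteq> Pow (Pow V)" using utree.edge_sub by fastforce
  qed (use fin in simp)
  have ES: "E \<in> ?S" using br utree_axioms by blast
  \<comment> \<open>Used twice: for some maximiser it identifies the maximum with the radius of
    \<open>F\<close>, and for \<open>E\<close>, once that value is attained, it gives the
    isomorphism.\<close>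
  have max_iso: "hypergraph_iso \<lparr>verts = V, edges = E'\<rparr> (F_hypertree n k) \<and> \<rho> E' = distance_spectral_radius (F_hypertree n k)"
    if E': "E' \<in> ?S" and max: "\<And>E''. E'' \<in> ?S \<Longrightarrow> \<rho> E'' \<le> \<rho> E'" for E'
  proof -
    obtain d' where d': "utree V E' k d'" and br': "branching E'" using E' by blast
    interpret U: utree V E' k d' by (rule d')
    have "(k - 1) * card E' = (k - 1) * card E" using U.count count by linarith
    moreover have "0 < k - 1" using assms(1) by simp
    ultimately have m': "4 \<le> card E'" using m nat_mult_eq_cancel1 by metis
    then have "E' \<noteq> {}" by auto
    then obtain x where x: "\<And>a. a \<in> V \<Longrightarrow> 0 < x a" "\<And>a. a \<in> V \<Longrightarrow> U.potential x a = U.radius * x a"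
      using U.perron by metis
    interpret M: maximal_utree V E' k d' x
      by unfold_locales (use x m' max in \<open>auto simp: \<rho>_def\<close>)
    have iso: "hypergraph_iso \<lparr>verts = V, edges = E'\<rparr> (F_hypertree n k)"
      using M.iso_F_hypertree[OF br'] n by simp
    then show ?thesis using U.radius_iso[OF iso] by (simp add: \<rho>_def)
  qed
  obtain E' where E': "E' \<in> ?S" "\<And>E''. E'' \<in> ?S \<Longrightarrow> \<rho> E'' \<le> \<rho> E'"
    using finite_obtains_max[OF S, of \<rho>] ES by blast
  have F: "\<rho> E' = distance_spectral_radius (F_hypertree n k)" using max_iso[OF E'] by blast
  have le: "\<rho> E \<le> distance_spectral_radius (F_hypertree n k)" using E'(2)[OF ES] F by simp
  have "hypergraph_iso T (F_hypertree n k)" if "\<rho> E = distance_spectral_radius (F_hypertree n k)"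
    using max_iso[OF ES] E'(2) F that T by simp
  moreover have "\<rho> E = distance_spectral_radius (F_hypertree n k)" if "hypergraph_iso T (F_hypertree n k)"
    using radius_iso[of "F_hypertree n k"] that T by (simp add: \<rho>_def)
  ultimately show ?thesis using le T by (auto simp: \<rho>_def)
qed

end
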